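(* Let $1 \leq p_0 < p_1 \leq \infty$, let $0<\theta<1$, and let $p_\theta$ satisfy \[ \frac{1}{p_\theta} = \frac{1-\theta}{p_0} + \frac{\theta}{p_1}. \] Then, for every $(f,A) \in L^{p_0}_{\mathrm{QHA}} \cap L^{p_1}_{\mathrm{QHA}}$, \[ \| (f,A) \|_{L^{p_\theta}} \leq \| (f,A) \|_{L^{p_0}}^{1-\theta} \, \| (f,A) \|_{L^{p_1}}^{\theta}. \]
   Context: Let $n\ge 1$ and $H = L^2(\mathbb{R}^n)$. For $1\le p<\infty$, $T^p(H)$ denotes the Schatten $p$-class of $H$ with norm $\|A\|_{T^p} = (\operatorname{tr}|A|^p)^{1/p}$; in particular $T^1(H)$ is the space of trace-class operators. For $p=\infty$, $\|A\|_{T^\infty}$ is the operator norm, and $\|f\|_{L^\infty}$ is the essential supremum norm. The quantum noncommutative $L^p$-space is \[ L^p_{\mathrm{QHA}} = \left\{ (f, A) \in L^1(\mathbb{R}^{2n}) \oplus T^1(H) : \| (f,A) \|_{L^p} := \|f\|_{L^p(\mathbb{R}^{2n})} + \|A\|_{T^p} < \infty \right\}. \] *)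

theory Defs
  imports
    "HOL-Analysis.Analysis"
    "HOL-Probability.Essential_Supremum"
    "HOL-Computational_Algebra.Polynomial"
begin

section \<open>The Hilbert space of square-integrable functions\<close>

definition square_integrable :: "(real ^ 'n \<Rightarrow> complex) \<Rightarrow> bool" where
  "square_integrable f \<longleftrightarrow>
     f \<in> borel_measurable lebesgue \<and> integrable lebesgue (\<lambda>x. (cmod (f x))\<^sup>2)"

lemma integrable_mult_cnj:
  assumes "square_integrable f" "square_integrable g"
  shows "integrable lebesgue (\<lambda>x. f x * cnj (g x))"
proof -
  have [measurable]: "f \<in> borel_measurable lebesgue" "g \<in> borel_measurable lebesgue"
    using assms by (auto simp: square_integrable_def)
  have "integrable lebesgue (\<lambda>x. (cmod (f x))\<^sup>2 + (cmod (g x))\<^sup>2)"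
    using assms by (auto simp: square_integrable_def)
  moreover have "(\<lambda>x. f x * cnj (g x)) \<in> borel_measurable lebesgue"
    by (intro borel_measurable_times measurable_compose[OF _ borel_measurable_continuous_onI[of cnj]]
        continuous_intros) simp_all
  moreover have "cmod (f x * cnj (g x)) \<le> norm ((cmod (f x))\<^sup>2 + (cmod (g x))\<^sup>2)" for x
  proof -
    have "0 \<le> (cmod (f x) - cmod (g x))\<^sup>2" "0 \<le> (cmod (f x))\<^sup>2" "0 \<le> (cmod (g x))\<^sup>2"
      "0 \<le> cmod (f x) * cmod (g x)"
      by simp_all
    then show ?thesis
      unfolding power2_diff norm_mult complex_mod_cnj real_norm_def by linarith
  qed
  ultimately show ?thesis
    by (auto intro: Bochner_Integration.integrable_bound)
qed

lemma square_integrable_zero: "square_integrable (\<lambda>x. 0)"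
  by (simp add: square_integrable_def)

lemma square_integrable_scale:
  assumes "square_integrable f"
  shows "square_integrable (\<lambda>x. c * f x)"
proof -
  have [measurable]: "f \<in> borel_measurable lebesgue"
    using assms by (auto simp: square_integrable_def)
  have "(\<lambda>x. c * f x) \<in> borel_measurable lebesgue"
    by measurable
  then show ?thesis
    using assms by (auto simp: square_integrable_def norm_mult power_mult_distrib)
qed

lemma square_integrable_add:
  assumes "square_integrable f" "square_integrable g"
  shows "square_integrable (\<lambda>x. f x + g x)"
proof -
  have [measurable]: "f \<in> borel_measurable lebesgue" "g \<in> borel_measurable lebesgue"
    using assms by (auto simp: square_integrable_def)
  have meas: "(\<lambda>x. f x + g x) \<in> borel_measurable lebesgue"
    by measurable
  have "integrable lebesgue (\<lambda>x. 2 * (cmod (f x))\<^sup>2 + 2 * (cmod (g x))\<^sup>2)"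
    using assms by (auto simp: square_integrable_def)
  moreover have "(\<lambda>x. (cmod (f x + g x))\<^sup>2) \<in> borel_measurable lebesgue"
    by measurable
  moreover have "norm ((cmod (f x + g x))\<^sup>2) \<le> norm (2 * (cmod (f x))\<^sup>2 + 2 * (cmod (g x))\<^sup>2)" for x
  proof -
    have "(cmod (f x + g x))\<^sup>2 \<le> (cmod (f x) + cmod (g x))\<^sup>2"
      by (simp add: norm_triangle_ineq power_mono)
    moreover have "0 \<le> (cmod (f x) - cmod (g x))\<^sup>2"
      by simp
    ultimately show ?thesis
      by (simp add: power2_diff power2_sum)
  qed
  ultimately have "integrable lebesgue (\<lambda>x. (cmod (f x + g x))\<^sup>2)"
    by (auto intro: Bochner_Integration.integrable_bound)
  with meas show ?thesis
    by (simp add: square_integrable_def)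
qed

definition l2_eq :: "(real ^ 'n \<Rightarrow> complex) \<Rightarrow> (real ^ 'n \<Rightarrow> complex) \<Rightarrow> bool" where
  "l2_eq f g \<longleftrightarrow> square_integrable f \<and> square_integrable g \<and> (AE x in lebesgue. f x = g x)"

quotient_type 'n l2 = "real ^ 'n::finite \<Rightarrow> complex" / partial: l2_eq
proof (rule part_equivpI)
  show "\<exists>f::real ^ 'n \<Rightarrow> complex. l2_eq f f"
    using square_integrable_zero by (auto simp: l2_eq_def)
  show "symp (l2_eq :: (real ^ 'n \<Rightarrow> complex) \<Rightarrow> _)"
    by (auto simp: l2_eq_def symp_def eq_commute)
  show "transp (l2_eq :: (real ^ 'n \<Rightarrow> complex) \<Rightarrow> _)"
    by (auto simp: l2_eq_def transp_def)
qed

lift_definition l2_scaleC :: "complex \<Rightarrow> 'n::finite l2 \<Rightarrow> 'n l2" is "\<lambda>c f x. c * f x"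
  by (auto simp: l2_eq_def square_integrable_scale)

lift_definition l2_cinner :: "'n::finite l2 \<Rightarrow> 'n l2 \<Rightarrow> complex"
  is "\<lambda>f g. integral\<^sup>L lebesgue (\<lambda>x. f x * cnj (g x))"
proof -
  fix f f' g g' :: "real ^ 'n \<Rightarrow> complex"
  assume "l2_eq f f'" "l2_eq g g'"
  then show "integral\<^sup>L lebesgue (\<lambda>x. f x * cnj (g x)) = integral\<^sup>L lebesgue (\<lambda>x. f' x * cnj (g' x))"
    using integrable_mult_cnj[of f g] integrable_mult_cnj[of f' g']
    by (intro integral_cong_AE) (auto simp: l2_eq_def elim: eventually_elim2)
qed

lemma l2_cinner_commute: "l2_cinner f g = cnj (l2_cinner g f)"
  by transfer (simp add: Bochner_Integration.integral_cnj[symmetric] mult.commute del: Bochner_Integration.integral_cnj)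

instantiation l2 :: (finite) real_vector
begin

lift_definition zero_l2 :: "'a l2" is "\<lambda>x. 0"
  by (simp add: l2_eq_def square_integrable_zero)

lift_definition plus_l2 :: "'a l2 \<Rightarrow> 'a l2 \<Rightarrow> 'a l2" is "\<lambda>f g x. f x + g x"
  by (auto simp: l2_eq_def square_integrable_add)

lift_definition scaleR_l2 :: "real \<Rightarrow> 'a l2 \<Rightarrow> 'a l2" is "\<lambda>r f x. complex_of_real r * f x"
  by (auto simp: l2_eq_def square_integrable_scale)

lift_definition uminus_l2 :: "'a l2 \<Rightarrow> 'a l2" is "\<lambda>f x. - f x"
  by (auto simp: l2_eq_def dest: square_integrable_scale[of _ "- 1"])

definition minus_l2 :: "'a l2 \<Rightarrow> 'a l2 \<Rightarrow> 'a l2" where "f - g = f + - g" for f g :: "'a l2"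

instance
proof
  fix f g h :: "'a l2" and r s :: real
  show "f + g + h = f + (g + h)"
    by transfer (auto simp: l2_eq_def add.assoc square_integrable_add)
  show "f + g = g + f"
    by transfer (auto simp: l2_eq_def add.commute square_integrable_add)
  show "0 + f = f"
    by transfer (auto simp: l2_eq_def)
  show "- f + f = 0"
    by transfer (auto simp: l2_eq_def square_integrable_zero)
  show "f - g = f + - g"
    by (rule minus_l2_def)
  show "r *\<^sub>R (f + g) = r *\<^sub>R f + r *\<^sub>R g"
    by transfer (auto simp: l2_eq_def distrib_left intro!: square_integrable_add square_integrable_scale)
  show "(r + s) *\<^sub>R f = r *\<^sub>R f + s *\<^sub>R f"
    by transfer (auto simp: l2_eq_def distrib_right intro!: square_integrable_add square_integrable_scale)
  show "r *\<^sub>R s *\<^sub>R f = (r * s) *\<^sub>R f"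
    by transfer (auto simp: l2_eq_def mult.assoc square_integrable_scale)
  show "1 *\<^sub>R f = f"
    by transfer (auto simp: l2_eq_def)
qed

end

text \<open>
  As a real inner product space, the space carries the real part of the complex inner product;
  this induces the usual \<open>L\<^sup>2\<close> norm and makes the library's bounded linear functions and their
  operator norm available.
\<close>

instantiation l2 :: (finite) real_inner
begin

definition inner_l2 :: "'a l2 \<Rightarrow> 'a l2 \<Rightarrow> real" where "f \<bullet> g = Re (l2_cinner f g)" for f g :: "'a l2"
definition norm_l2 :: "'a l2 \<Rightarrow> real" where "norm f = sqrt (f \<bullet> f)" for f :: "'a l2"
definition sgn_l2 :: "'a l2 \<Rightarrow> 'a l2" where "sgn f = f /\<^sub>R norm f" for f :: "'a l2"
definition dist_l2 :: "'a l2 \<Rightarrow> 'a l2 \<Rightarrow> real" where "dist f g = norm (f - g)" for f g :: "'a l2"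
definition uniformity_l2 :: "('a l2 \<times> 'a l2) filter" where
  "uniformity_l2 = (INF e\<in>{0 <..}. principal {(f, g). dist f g < e})"
definition open_l2 :: "'a l2 set \<Rightarrow> bool" where
  "open_l2 U \<longleftrightarrow> (\<forall>f\<in>U. \<forall>\<^sub>F (f', g) in uniformity. f' = f \<longrightarrow> g \<in> U)"

instance
proof
  fix f g h :: "'a l2" and r :: real
  show "sgn f = f /\<^sub>R norm f"
    by (rule sgn_l2_def)
  show "dist f g = norm (f - g)"
    by (rule dist_l2_def)
  show "uniformity = (INF e\<in>{0 <..}. principal {(f, g :: 'a l2). dist f g < e})"
    by (rule uniformity_l2_def)
  show "open U \<longleftrightarrow> (\<forall>f\<in>U. \<forall>\<^sub>F (f', g) in uniformity. f' = f \<longrightarrow> g \<in> U)" for U :: "'a l2 set"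
    by (rule open_l2_def)
  show "f \<bullet> g = g \<bullet> f"
    by (simp add: inner_l2_def l2_cinner_commute[of g f])
  show "(f + g) \<bullet> h = f \<bullet> h + g \<bullet> h"
    unfolding inner_l2_def
    by transfer (simp add: l2_eq_def distrib_right integrable_mult_cnj)
  show "(r *\<^sub>R f) \<bullet> g = r * (f \<bullet> g)"
    unfolding inner_l2_def
    by transfer (simp add: l2_eq_def mult.assoc)
  have self: "Re (integral\<^sup>L lebesgue (\<lambda>x. f x * cnj (f x))) = integral\<^sup>L lebesgue (\<lambda>x. (cmod (f x))\<^sup>2)"
    for f :: "real ^ 'a \<Rightarrow> complex"
    by (simp add: complex_norm_square[symmetric] del: of_real_power)
  show "0 \<le> f \<bullet> f"
    unfolding inner_l2_def
    by transfer (simp add: self)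
  show "f \<bullet> f = 0 \<longleftrightarrow> f = 0"
    unfolding inner_l2_def
    by transfer (auto simp: self l2_eq_def square_integrable_zero integral_nonneg_eq_0_iff_AE
        square_integrable_def)
  show "norm f = sqrt (f \<bullet> f)"
    by (rule norm_l2_def)
qed

end


section \<open>Schatten norms\<close>

definition complex_linear :: "('n::finite l2 \<Rightarrow>\<^sub>L 'n l2) \<Rightarrow> bool" where
  "complex_linear A \<longleftrightarrow> (\<forall>c f. blinfun_apply A (l2_scaleC c f) = l2_scaleC c (blinfun_apply A f))"

definition l2_adjoint :: "('n::finite l2 \<Rightarrow>\<^sub>L 'n l2) \<Rightarrow> ('n l2 \<Rightarrow>\<^sub>L 'n l2)" where
  "l2_adjoint A = (THE B. \<forall>f g. l2_cinner (blinfun_apply A f) g = l2_cinner f (blinfun_apply B g))"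

definition blinfun_poly ::
    "real poly \<Rightarrow> ('a::real_normed_vector \<Rightarrow>\<^sub>L 'a) \<Rightarrow> ('a \<Rightarrow>\<^sub>L 'a)" where
  "blinfun_poly q B = (\<Sum>i\<le>degree q. coeff q i *\<^sub>R (((o\<^sub>L) B ^^ i) id_blinfun))"

text \<open>
  Continuous functional calculus for a positive operator \<open>B\<close>, whose spectrum lies in
  \<open>[0, \<parallel>B\<parallel>]\<close>: \<open>g(B)\<close> is the limit in operator norm of \<open>q\<^sub>k(B)\<close> for any polynomials \<open>q\<^sub>k\<close>
  converging to \<open>g\<close> uniformly on that interval.
\<close>

definition fun_calc :: "(real \<Rightarrow> real) \<Rightarrow> ('a::real_normed_vector \<Rightarrow>\<^sub>L 'a) \<Rightarrow> ('a \<Rightarrow>\<^sub>L 'a)" where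
  "fun_calc g B = (THE C. \<forall>q. uniform_limit {0..norm B} (\<lambda>k t. poly (q k) t) g sequentially \<longrightarrow>
                               (\<lambda>k. blinfun_poly (q k) B) \<longlonglongrightarrow> C)"

definition blinfun_abs :: "('n::finite l2 \<Rightarrow>\<^sub>L 'n l2) \<Rightarrow> ('n l2 \<Rightarrow>\<^sub>L 'n l2)" where
  "blinfun_abs A = fun_calc sqrt (l2_adjoint A o\<^sub>L A)"

definition orthonormal :: "'n::finite l2 set \<Rightarrow> bool" where
  "orthonormal E \<longleftrightarrow> (\<forall>e\<in>E. norm e = 1) \<and> (\<forall>e\<in>E. \<forall>f\<in>E. e \<noteq> f \<longrightarrow> l2_cinner e f = 0)"

definition orthonormal_basis :: "'n::finite l2 set \<Rightarrow> bool" where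
  "orthonormal_basis E \<longleftrightarrow> orthonormal E \<and> (\<forall>f. (\<forall>e\<in>E. l2_cinner f e = 0) \<longrightarrow> f = 0)"

lemma l2_cinner_scaleR_left: "l2_cinner (r *\<^sub>R f) g = of_real r * l2_cinner f g"
  by transfer (simp add: l2_eq_def mult.assoc)

lemma orthonormal_basis_exists: "\<exists>E. orthonormal_basis (E :: 'n::finite l2 set)"
proof -
  have "\<exists>M\<in>Collect orthonormal. \<forall>X\<in>Collect orthonormal. M \<subseteq> X \<longrightarrow> X = (M :: 'n l2 set)"
  proof (rule subset_Zorn_nonempty)
    show "Collect orthonormal \<noteq> ({} :: 'n l2 set set)"
      by (auto simp: orthonormal_def intro: exI[of _ "{}"])
    fix C :: "'n l2 set set"
    assume "C \<noteq> {}" and C: "subset.chain (Collect orthonormal) C"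
    have "l2_cinner e f = 0" if ef: "X \<in> C" "Y \<in> C" "e \<in> X" "f \<in> Y" "e \<noteq> f" for e f X Y
    proof -
      have "X \<subseteq> Y \<or> Y \<subseteq> X" "orthonormal X" "orthonormal Y"
        using C ef by (auto simp: subset_chain_def)
      then show ?thesis
        using ef unfolding orthonormal_def by blast
    qed
    then show "\<Union> C \<in> Collect orthonormal"
      using C by (auto simp: orthonormal_def subset_chain_def)
  qed
  then obtain M :: "'n l2 set" where M: "orthonormal M"
    and max: "\<And>X. orthonormal X \<Longrightarrow> M \<subseteq> X \<Longrightarrow> X = M"
    by blast
  have "f = 0" if f: "\<forall>e\<in>M. l2_cinner f e = 0" for f
  proof (rule ccontr)
    assume "f \<noteq> 0"
    define u where "u = (1 / norm f) *\<^sub>R f"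
    have u1: "norm u = 1"
      using \<open>f \<noteq> 0\<close> by (simp add: u_def)
    have ue: "l2_cinner u e = 0" "l2_cinner e u = 0" if "e \<in> M" for e
      using f that l2_cinner_commute[of e u] by (simp_all add: u_def l2_cinner_scaleR_left)
    have "orthonormal (insert u M)"
      using M u1 ue by (auto simp: orthonormal_def)
    then have "u \<in> M"
      using max[of "insert u M"] by blast
    then have "u \<bullet> u = 0"
      using ue by (simp add: inner_l2_def)
    then show False
      using u1 by simp
  qed
  with M show ?thesis
    by (auto simp: orthonormal_basis_def)
qed

text \<open>
  The trace of a positive operator, with values in \<open>[0, \<infinity>]\<close>; it does not depend on
  the orthonormal basis.
\<close>

definition trace_pos :: "('n::finite l2 \<Rightarrow>\<^sub>L 'n l2) \<Rightarrow> ennreal" where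
  "trace_pos B =
     (\<Sum>\<^sub>\<infinity>e\<in>(SOME E. orthonormal_basis E). ennreal (Re (l2_cinner (blinfun_apply B e) e)))"

text \<open>Real powers on \<open>[0, \<infinity>]\<close>, for positive exponents only.\<close>

definition ennreal_powr :: "ennreal \<Rightarrow> real \<Rightarrow> ennreal" where
  "ennreal_powr x a = (if x = \<infinity> then \<infinity> else ennreal (enn2real x powr a))"

definition schatten_norm :: "ennreal \<Rightarrow> ('n::finite l2 \<Rightarrow>\<^sub>L 'n l2) \<Rightarrow> ennreal" where
  "schatten_norm p A =
     (if p = \<infinity> then ennreal (norm A)
      else ennreal_powr (trace_pos (fun_calc (\<lambda>t. t powr enn2real p) (blinfun_abs A)))
             (1 / enn2real p))"

definition schatten_class :: "ennreal \<Rightarrow> ('n::finite l2 \<Rightarrow>\<^sub>L 'n l2) set" where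
  "schatten_class p = {A. complex_linear A \<and> schatten_norm p A < \<infinity>}"


section \<open>Quantum noncommutative Lebesgue spaces\<close>

definition Lp_norm :: "ennreal \<Rightarrow> ('a::euclidean_space \<Rightarrow> complex) \<Rightarrow> ennreal" where
  "Lp_norm p f =
     (if p = \<infinity> then esssup lebesgue (\<lambda>x. ennreal (cmod (f x)))
      else ennreal_powr (\<integral>\<^sup>+x. ennreal (cmod (f x) powr enn2real p) \<partial>lebesgue) (1 / enn2real p))"

definition QHA_norm ::
    "ennreal \<Rightarrow> (real ^ ('n + 'n) \<Rightarrow> complex) \<times> ('n::finite l2 \<Rightarrow>\<^sub>L 'n l2) \<Rightarrow> ennreal" where
  "QHA_norm p = (\<lambda>(f, A). Lp_norm p f + schatten_norm p A)"

text \<open>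
  The function component is given by a representative; every notion used is invariant under
  almost-everywhere equality.
\<close>

definition Lp_QHA ::
    "ennreal \<Rightarrow> ((real ^ ('n + 'n) \<Rightarrow> complex) \<times> ('n::finite l2 \<Rightarrow>\<^sub>L 'n l2)) set" where
  "Lp_QHA p = {(f, A). integrable lebesgue f \<and> A \<in> schatten_class 1 \<and> QHA_norm p (f, A) < \<infinity>}"

end

theory Submission
  imports Defs
begin

text \<open>
  For \<open>0 < s < 1\<close> and \<open>x, y \<ge> 0\<close> the weighted geometric mean is an infimum of linear functions,
  \<open>x powr (1 - s) * y powr s = (INF c\<in>{0<..}. (1 - s) * c powr s * x + s * c powr (s - 1) * y)\<close>;
  the two halves are \<open>weighted_geometric_le_arithmetic\<close> and \<open>le_weighted_geometric_mean\<close>. Hence, for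
  \<open>p = (1 - s) p\<^sub>0 + s p\<^sub>1\<close>, the power \<open>t powr p\<close> lies below a linear combination of \<open>t powr p\<^sub>0\<close> and
  \<open>t powr p\<^sub>1\<close> for each scale \<open>c\<close>. Such a linear inequality survives every positive linear functional:
  the integral, applied to \<open>t = \<bar>f x\<bar>\<close>, and the trace of the functional calculus of \<open>\<bar>A\<bar>\<close>. Optimising
  over \<open>c\<close> afterwards gives log-convexity of the moments \<open>\<integral>\<bar>f\<bar>\<^sup>p\<close> and \<open>tr \<bar>A\<bar>\<^sup>p\<close>, and rescaling the
  exponents gives the interpolation inequality for each of the two norms (\<open>moment_interpolation\<close>). If
  \<open>p\<^sub>1 = \<infinity>\<close>, the inequality \<open>t powr p \<le> K powr (p - p\<^sub>0) * t powr p\<^sub>0\<close> on \<open>[0, K]\<close> takes the place of the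
  linear combination. The sum of the two norms is handled by Hoelder's inequality for two terms, which
  is a further instance of the same infimum.

  The operator side rests on the facts that make \<open>l2_adjoint\<close> and \<open>fun_calc\<close> the intended objects.
  The space of square-integrable functions is complete, so the Riesz representation theorem provides
  adjoints, and the bounded operators form a Banach space. The functional calculus of a positive
  operator \<open>B\<close> is built on one fact: a polynomial that is nonnegative on \<open>[0, norm B]\<close> has a nonnegative
  quadratic form at \<open>B\<close> (\<open>inner_blinfun_poly_nonneg\<close>). It holds because a polynomial that is strictly positive on
  \<open>[0, 1]\<close> is a nonnegative combination of products of powers of \<open>X\<close> and \<open>1 - X\<close>. The norm bound for polynomials in
  \<open>B\<close>, the existence of the calculus for continuous functions and its positivity follow from it.
\<close>

section \<open>Weighted geometric means as infima of linear functions\<close>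

text \<open>
  Young's inequality with a free scale \<open>c\<close>: the factors \<open>c powr s\<close> and \<open>c powr (s - 1)\<close> cancel in the
  weighted geometric mean of \<open>c powr s * x\<close> and \<open>c powr (s - 1) * y\<close>, so the left side does not see \<open>c\<close>.
\<close>

lemma weighted_geometric_le_arithmetic:
  fixes x y c s :: real
  assumes "0 \<le> x" "0 \<le> y" "0 < c" "0 < s" "s < 1"
  shows "x powr (1 - s) * y powr s \<le> (1 - s) * c powr s * x + s * c powr (s - 1) * y"
proof (cases "x = 0 \<or> y = 0")
  case True
  then show ?thesis using assms by auto
next
  case False
  then have pos: "0 < x" "0 < y" using assms by auto
  have "(c powr s * x) powr (1 - s) * (c powr (s - 1) * y) powr s
      \<le> (1 - s) * (c powr s * x) + s * (c powr (s - 1) * y)"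
    using assms pos by (intro Youngs_inequality_0) auto
  moreover have "(c powr s * x) powr (1 - s) * (c powr (s - 1) * y) powr s = x powr (1 - s) * y powr s"
  proof -
    have "c powr (s * (1 - s)) * c powr ((s - 1) * s) = 1"
      using assms by (simp add: powr_add[symmetric] algebra_simps)
    then show ?thesis
      using assms pos by (simp add: powr_mult powr_powr)
  qed
  ultimately show ?thesis by (simp add: mult.assoc)
qed

text \<open>
  The converse: optimising over the scale recovers the geometric mean. For positive \<open>x\<close> and \<open>y\<close> the
  optimal scale is \<open>c = y / x\<close>, at which both terms are multiples of \<open>x powr (1 - s) * y powr s\<close>. When
  exactly one of them vanishes the infimum is not attained; shifting both by \<open>e > 0\<close> and letting \<open>e\<close> tend to
  \<open>0\<close> treats all cases at once.
\<close>

lemma le_weighted_geometric_mean: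
  fixes x y s t :: real
  assumes "0 \<le> x" "0 \<le> y" "0 < s" "s < 1"
    and le: "\<And>c. 0 < c \<Longrightarrow> t \<le> (1 - s) * c powr s * x + s * c powr (s - 1) * y"
  shows "t \<le> x powr (1 - s) * y powr s"
proof -
  have bound: "t \<le> (x + e) powr (1 - s) * (y + e) powr s" if "0 < e" for e
  proof -
    have pos: "0 < x + e" "0 < y + e" using assms that by auto
    define c where "c = (y + e) / (x + e)"
    have "0 < c" using pos by (simp add: c_def)
    have "t \<le> (1 - s) * c powr s * x + s * c powr (s - 1) * y"
      using \<open>0 < c\<close> by (rule le)
    also have "\<dots> \<le> (1 - s) * c powr s * (x + e) + s * c powr (s - 1) * (y + e)"
      using assms that by (intro add_mono mult_left_mono) auto
    also have "\<dots> = (1 - s) * (c powr s * (x + e)) + s * (c powr (s - 1) * (y + e))"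
      by (simp add: mult.assoc)
    also have "c powr s * (x + e) = (x + e) powr (1 - s) * (y + e) powr s"
      using pos by (simp add: c_def powr_divide powr_diff)
    also have "c powr (s - 1) * (y + e) = (x + e) powr (1 - s) * (y + e) powr s"
      using pos by (simp add: c_def powr_divide powr_diff)
    finally show ?thesis by (simp add: algebra_simps)
  qed
  have lim: "((\<lambda>e. (x + e) powr (1 - s) * (y + e) powr s) \<longlongrightarrow> (x + 0) powr (1 - s) * (y + 0) powr s) (at_right 0)"
    using assms
    by (intro tendsto_intros tendsto_powr') (auto simp: eventually_at_filter)
  have "eventually (\<lambda>e. t \<le> (x + e) powr (1 - s) * (y + e) powr s) (at_right 0)"
    using bound by (auto simp: eventually_at_filter)
  from tendsto_lowerbound[OF lim this] show ?thesis by simp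
qed

text \<open>
  Each summand on the left is bounded by its own linear majorant with a common scale \<open>c\<close>; the majorants
  add up, and the scale is optimised only after the addition. The same mechanism, with the sum replaced
  by an integral or by a trace, gives the interpolation inequalities below.
\<close>

lemma Hoelder_two_terms:
  fixes a\<^sub>0 a\<^sub>1 b\<^sub>0 b\<^sub>1 s :: real
  assumes "0 \<le> a\<^sub>0" "0 \<le> a\<^sub>1" "0 \<le> b\<^sub>0" "0 \<le> b\<^sub>1" "0 < s" "s < 1"
  shows "a\<^sub>0 powr (1 - s) * a\<^sub>1 powr s + b\<^sub>0 powr (1 - s) * b\<^sub>1 powr s
    \<le> (a\<^sub>0 + b\<^sub>0) powr (1 - s) * (a\<^sub>1 + b\<^sub>1) powr s"
proof (rule le_weighted_geometric_mean)
  fix c :: real assume "0 < c"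
  then show "a\<^sub>0 powr (1 - s) * a\<^sub>1 powr s + b\<^sub>0 powr (1 - s) * b\<^sub>1 powr s
      \<le> (1 - s) * c powr s * (a\<^sub>0 + b\<^sub>0) + s * c powr (s - 1) * (a\<^sub>1 + b\<^sub>1)"
    using weighted_geometric_le_arithmetic[of a\<^sub>0 a\<^sub>1 c s] weighted_geometric_le_arithmetic[of b\<^sub>0 b\<^sub>1 c s] assms
    by (simp add: algebra_simps)
qed (use assms in auto)

section \<open>The Riesz representation theorem and adjoints\<close>

text \<open>
  A minimising sequence of the strictly convex functional \<open>(norm v)\<^sup>2 - 2 * \<phi> v\<close> is Cauchy by the
  parallelogram law: the squared distance of two points is controlled by how far their values exceed
  the infimum, because the value at their midpoint cannot fall below it.
\<close>

lemma bounded_linear_minimizer: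
  fixes \<phi> :: "'a::{real_inner, complete_space} \<Rightarrow> real"
  assumes "bounded_linear \<phi>"
  obtains u where "\<And>v. (norm u)\<^sup>2 - 2 * \<phi> u \<le> (norm v)\<^sup>2 - 2 * \<phi> v"
proof -
  interpret \<phi>: bounded_linear \<phi> by fact
  define J where "J = (\<lambda>v. (norm v)\<^sup>2 - 2 * \<phi> v)"
  have "- (onorm \<phi>)\<^sup>2 \<le> J v" for v
  proof -
    have "\<phi> v \<le> onorm \<phi> * norm v"
      using onorm[OF assms, of v] by auto
    moreover have "0 \<le> (norm v - onorm \<phi>)\<^sup>2" by simp
    ultimately show ?thesis unfolding J_def power2_diff by (simp add: algebra_simps)
  qed
  then have bdd: "bdd_below (range J)" by (intro bdd_belowI[of _ "- (onorm \<phi>)\<^sup>2"]) auto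
  define m where "m = Inf (range J)"
  have m_le: "m \<le> J v" for v
    unfolding m_def by (rule cInf_lower[OF _ bdd]) simp
  have "\<exists>v. J v < m + inverse (Suc n)" for n
    using cInf_lessD[of "range J" "m + inverse (Suc n)"] by (auto simp: m_def)
  then obtain w where w: "\<And>n. J (w n) < m + inverse (Suc n)" by metis
  have parallelogram: "(dist u v)\<^sup>2 \<le> 2 * (J u - m) + 2 * (J v - m)" for u v
  proof -
    have "(dist u v)\<^sup>2 = 2 * J u + 2 * J v - 4 * J ((1/2) *\<^sub>R (u + v))"
      unfolding J_def dist_norm power2_norm_eq_inner
      by (simp add: \<phi>.add \<phi>.scaleR inner_diff inner_add inner_commute field_simps)
    then show ?thesis using m_le[of "(1/2) *\<^sub>R (u + v)"] by simp
  qed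
  have "Cauchy w"
  proof (rule metric_CauchyI)
    fix e :: real assume "0 < e"
    then obtain N where N: "inverse (real (Suc N)) < e\<^sup>2 / 4"
      using reals_Archimedean[of "e\<^sup>2 / 4"] by auto
    have "dist (w i) (w j) < e" if "N \<le> i" "N \<le> j" for i j
    proof -
      have "inverse (real (Suc i)) \<le> inverse (real (Suc N))" "inverse (real (Suc j)) \<le> inverse (real (Suc N))"
        using that by (auto intro!: le_imp_inverse_le)
      then have "J (w i) - m < e\<^sup>2 / 4" "J (w j) - m < e\<^sup>2 / 4"
        using w[of i] w[of j] N by argo+
      then have "(dist (w i) (w j))\<^sup>2 < e\<^sup>2"
        by (intro le_less_trans[OF parallelogram]) argo
      then show ?thesis using \<open>0 < e\<close> by (simp add: power_less_imp_less_base)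
    qed
    then show "\<exists>N. \<forall>i\<ge>N. \<forall>j\<ge>N. dist (w i) (w j) < e" by blast
  qed
  then obtain u where u: "w \<longlonglongrightarrow> u" using Cauchy_convergent convergent_def by blast
  have "(\<lambda>n. J (w n)) \<longlonglongrightarrow> J u"
    unfolding J_def by (intro tendsto_intros \<phi>.tendsto u)
  moreover have "(\<lambda>n. m + inverse (real (Suc n))) \<longlonglongrightarrow> m"
    using tendsto_add[OF tendsto_const[of m] LIMSEQ_inverse_real_of_nat] by simp
  ultimately have "J u \<le> m"
    using w by (intro LIMSEQ_le) (auto intro: less_imp_le)
  then show thesis
    using m_le by (intro that[of u]) (auto simp: J_def intro: order_trans)
qed

text \<open>
  The minimiser \<open>u\<close> represents \<open>\<phi>\<close>: the minimised functional is a quadratic polynomial along each line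
  through \<open>u\<close>, so the linear coefficient \<open>inner v u - \<phi> v\<close> must vanish.
\<close>

lemma Riesz_representation:
  fixes \<phi> :: "'a::{real_inner, complete_space} \<Rightarrow> real"
  assumes "bounded_linear \<phi>"
  obtains u where "\<And>v. \<phi> v = inner v u"
proof -
  interpret \<phi>: bounded_linear \<phi> by fact
  obtain u where u: "\<And>v. (norm u)\<^sup>2 - 2 * \<phi> u \<le> (norm v)\<^sup>2 - 2 * \<phi> v"
    using bounded_linear_minimizer[OF assms] by metis
  have "\<phi> v = inner v u" for v
  proof -
    define d where "d = inner v u - \<phi> v"
    \<comment> \<open>A step \<open>t\<close> that would decrease the functional unless \<open>d = 0\<close>; the summand 1 covers \<open>v = 0\<close>.\<close>
    define K where "K = (norm v)\<^sup>2 + 1"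
    have pos: "0 < K" by (simp add: K_def add_nonneg_pos)
    define t where "t = - d / K"
    have "0 \<le> t\<^sup>2 * (norm v)\<^sup>2 + 2 * t * d"
      using u[of "u + t *\<^sub>R v"] unfolding d_def power2_norm_eq_inner
      by (simp add: \<phi>.add \<phi>.scaleR inner_commute algebra_simps power2_eq_square)
    also have "\<dots> \<le> t\<^sup>2 * K + 2 * t * d" by (simp add: K_def mult_left_mono)
    also have "\<dots> = - (d\<^sup>2 / K)"
      using pos by (simp add: t_def field_simps power2_eq_square)
    finally have "d\<^sup>2 / K \<le> 0" by simp
    then have "d = 0" using pos by (simp add: divide_le_0_iff)
    then show ?thesis by (simp add: d_def)
  qed
  then show thesis by (rule that)
qed

lemma adjoint_blinfun_exists:
  fixes A :: "'a::{real_inner, complete_space} \<Rightarrow>\<^sub>L 'a"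
  obtains B :: "'a \<Rightarrow>\<^sub>L 'a" where "\<And>x y. inner (A x) y = inner x (B y)" and "norm B \<le> norm A"
proof -
  have "\<exists>u. \<forall>x. inner (A x) y = inner x u" for y
    by (rule Riesz_representation[of "\<lambda>x. inner (A x) y"])
      (auto intro: bounded_linear_compose[OF bounded_linear_inner_left blinfun.bounded_linear_right])
  then obtain b where b: "\<And>x y. inner (A x) y = inner x (b y)" by metis
  have norm_b: "norm (b y) \<le> norm y * norm A" for y
  proof -
    have "(norm (b y))\<^sup>2 = inner (A (b y)) y"
      by (simp add: b power2_norm_eq_inner)
    also have "\<dots> \<le> norm A * norm (b y) * norm y"
      using norm_cauchy_schwarz[of "A (b y)" y] mult_right_mono[OF norm_blinfun[of A "b y"], of "norm y"]
      by simp
    finally show ?thesis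
      by (cases "b y = 0") (auto simp: power2_eq_square field_simps)
  qed
  have "bounded_linear b"
  proof (rule bounded_linear_intro[where K = "norm A"])
    show "b (y + z) = b y + b z" for y z
      by (rule vector_eq_rdot[THEN iffD1]) (metis b inner_add_right inner_commute)
    show "b (r *\<^sub>R y) = r *\<^sub>R b y" for r y
      by (rule vector_eq_rdot[THEN iffD1]) (metis b inner_scaleR_right inner_commute)
  qed (rule norm_b)
  then have app: "blinfun_apply (Blinfun b) = b" by (rule bounded_linear_Blinfun_apply)
  show thesis
    by (rule that[of "Blinfun b"])
      (use b norm_b in \<open>auto simp: app mult.commute intro!: norm_blinfun_bound\<close>)
qed

section \<open>Completeness of the space of square-integrable functions\<close>

lemma norm_abs_l2:
  assumes "square_integrable f"
  shows "ennreal ((norm (abs_l2 f))\<^sup>2) = (\<integral>\<^sup>+x. ennreal ((cmod (f x))\<^sup>2) \<partial>lebesgue)"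
proof -
  have "(norm (abs_l2 f))\<^sup>2 = Re (integral\<^sup>L lebesgue (\<lambda>x. f x * cnj (f x)))"
    using assms by (simp add: power2_norm_eq_inner inner_l2_def l2_cinner.abs_eq l2_eq_def)
  also have "\<dots> = integral\<^sup>L lebesgue (\<lambda>x. (cmod (f x))\<^sup>2)"
    by (simp add: complex_norm_square[symmetric] del: of_real_power)
  finally show ?thesis
    using assms by (simp add: nn_integral_eq_integral square_integrable_def)
qed

lemma square_integrable_iff:
  "square_integrable f \<longleftrightarrow>
    f \<in> borel_measurable lebesgue \<and> (\<integral>\<^sup>+x. ennreal ((cmod (f x))\<^sup>2) \<partial>lebesgue) < \<infinity>"
  by (auto simp: square_integrable_def integrable_iff_bounded)

lemma square_integrable_diff:
  assumes "square_integrable f" "square_integrable g"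
  shows "square_integrable (\<lambda>x. f x - g x)"
  using square_integrable_add[OF assms(1) square_integrable_scale[OF assms(2), of "- 1"]] by simp

lemma abs_l2_diff:
  assumes "square_integrable f" "square_integrable g"
  shows "abs_l2 f - abs_l2 g = abs_l2 (\<lambda>x. f x - g x)"
  using assms square_integrable_scale[OF assms(2), of "- 1"]
  by (simp add: minus_l2_def uminus_l2.abs_eq plus_l2.abs_eq l2_eq_def)

lemma square_integrable_rep_l2: "square_integrable (rep_l2 x)"
  using Quotient3_rep_reflp[OF Quotient3_l2, of x] by (simp add: l2_eq_def)

lemma dist_abs_l2:
  assumes "square_integrable f"
  shows "ennreal ((dist x (abs_l2 f))\<^sup>2)
    = (\<integral>\<^sup>+t. ennreal ((cmod (rep_l2 x t - f t))\<^sup>2) \<partial>lebesgue)"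
proof -
  have "x - abs_l2 f = abs_l2 (\<lambda>t. rep_l2 x t - f t)"
    using abs_l2_diff[OF square_integrable_rep_l2[of x] assms]
    by (simp add: Quotient3_abs_rep[OF Quotient3_l2])
  then show ?thesis
    using norm_abs_l2[OF square_integrable_diff[OF square_integrable_rep_l2[of x] assms]]
    by (simp add: dist_norm)
qed

lemma dist_l2_rep:
  "ennreal ((dist x y)\<^sup>2) = (\<integral>\<^sup>+t. ennreal ((cmod (rep_l2 x t - rep_l2 y t))\<^sup>2) \<partial>lebesgue)"
  using dist_abs_l2[OF square_integrable_rep_l2[of y], of x]
  by (simp add: Quotient3_abs_rep[OF Quotient3_l2])

lemma half_power_square: "((1/2) ^ k)\<^sup>2 = (1/4 :: real) ^ k"
  unfolding power2_eq_square power_mult_distrib[symmetric] by simp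

text \<open>
  The weights \<open>2 ^ k\<close> leave the integral of \<open>\<Sum>k. 2 ^ k * (cmod (g (Suc k) x - g k x))\<^sup>2\<close> finite, so this sum is finite
  almost everywhere. By the inequality \<open>d \<le> 2 ^ k * d\<^sup>2 + (1/2) ^ k\<close> the increments are then absolutely
  summable.
\<close>

lemma AE_convergent_of_fast_Cauchy:
  fixes g :: "nat \<Rightarrow> 'a \<Rightarrow> complex"
  assumes [measurable]: "\<And>k. g k \<in> borel_measurable M"
    and fast: "\<And>k. (\<integral>\<^sup>+x. ennreal ((cmod (g (Suc k) x - g k x))\<^sup>2) \<partial>M) \<le> ennreal ((1/4) ^ k)"
  shows "AE x in M. convergent (\<lambda>k. g k x)"
proof -
  define D where "D = (\<lambda>k x. 2 ^ k * (cmod (g (Suc k) x - g k x))\<^sup>2)"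
  have [measurable]: "D k \<in> borel_measurable M" for k
    unfolding D_def by measurable
  have int_D: "(\<integral>\<^sup>+x. ennreal (D k x) \<partial>M) \<le> ennreal ((1/2) ^ k)" for k
  proof -
    have "(\<integral>\<^sup>+x. ennreal (D k x) \<partial>M)
        = ennreal (2 ^ k) * (\<integral>\<^sup>+x. ennreal ((cmod (g (Suc k) x - g k x))\<^sup>2) \<partial>M)"
      unfolding D_def by (simp add: ennreal_mult' nn_integral_cmult)
    also have "\<dots> \<le> ennreal (2 ^ k) * ennreal ((1/4) ^ k)"
      by (intro mult_left_mono fast) auto
    also have "\<dots> = ennreal (2 ^ k * (1/4) ^ k)"
      by (rule ennreal_mult''[symmetric]) simp
    also have "2 ^ k * (1/4) ^ k = (1/2 :: real) ^ k"
      unfolding power_mult_distrib[symmetric] by simp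
    finally show ?thesis .
  qed
  have "(\<integral>\<^sup>+x. (\<Sum>k. ennreal (D k x)) \<partial>M) = (\<Sum>k. \<integral>\<^sup>+x. ennreal (D k x) \<partial>M)"
    by (intro nn_integral_suminf) simp
  also have "\<dots> \<le> (\<Sum>k. ennreal ((1/2) ^ k))"
    by (intro suminf_le int_D) auto
  also have "\<dots> < \<infinity>"
    by (subst suminf_ennreal2) (auto intro: summable_geometric)
  finally have "AE x in M. (\<Sum>k. ennreal (D k x)) \<noteq> \<infinity>"
    by (intro nn_integral_PInf_AE) auto
  then show ?thesis
  proof eventually_elim
    case (elim x)
    have D: "summable (\<lambda>k. D k x)"
      using elim by (intro summable_suminf_not_top) (auto simp: D_def)
    have le: "norm (g (Suc k) x - g k x) \<le> D k x + (1/2) ^ k" for k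
    proof -
      define d where "d = cmod (g (Suc k) x - g k x)"
      have "0 \<le> (2 ^ k * d - 1)\<^sup>2 + 2 ^ k * d" by (simp add: d_def)
      then have "2 ^ k * d \<le> 2 ^ k * (2 ^ k * d\<^sup>2 + (1/2) ^ k)"
        by (simp add: power2_diff power_mult_distrib power2_eq_square algebra_simps power_one_over)
      then show ?thesis by (simp add: D_def d_def)
    qed
    have "summable (\<lambda>k. g (Suc k) x - g k x)"
      by (rule summable_comparison_test'[OF summable_add[OF D summable_geometric[of "1/2"]] le]) simp
    then have "convergent (\<lambda>n. g 0 x + (\<Sum>k<n. g (Suc k) x - g k x))"
      by (intro convergent_add[OF convergent_const]) (simp only: summable_iff_convergent)
    then show ?case by (simp add: sum_lessThan_telescope[of "\<lambda>k. g k x"])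
  qed
qed

text \<open>
  Completeness of the space of square-integrable functions (Riesz-Fischer). Representatives of
  suitably chosen, rapidly approaching terms converge almost everywhere, and Fatou's lemma turns the bounds on the
  distances within the sequence into bounds on the distance to the pointwise limit. This makes the
  bounded operators a Banach space, in which the limits that define the functional calculus exist.
\<close>

instance l2 :: (finite) banach
proof
  fix X :: "nat \<Rightarrow> 'a l2"
  assume "Cauchy X"
  then have "\<forall>k. \<exists>N. \<forall>m\<ge>N. \<forall>n\<ge>N. dist (X m) (X n) < (1/2) ^ k"
    unfolding Cauchy_def by (metis zero_less_power half_gt_zero zero_less_one)
  then obtain N where N: "\<And>k m n. N k \<le> m \<Longrightarrow> N k \<le> n \<Longrightarrow> dist (X m) (X n) < (1/2) ^ k"
    by metis
  \<comment> \<open>Summing the thresholds makes \<open>r j\<close> exceed \<open>N k\<close> for every \<open>k \<le> j\<close>.\<close>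
  define r where "r = (\<lambda>k. \<Sum>i\<le>k. N i)"
  have r: "N k \<le> r j" if "k \<le> j" for k j
    unfolding r_def using that by (intro member_le_sum) auto
  define g where "g = (\<lambda>k. rep_l2 (X (r k)))"
  have meas[measurable]: "rep_l2 x \<in> borel_measurable lebesgue" for x :: "'a l2"
    using square_integrable_rep_l2[of x] by (simp add: square_integrable_def)
  have [measurable]: "g k \<in> borel_measurable lebesgue" for k
    by (simp add: g_def)
  have sq: "ennreal ((dist (X m) (X n))\<^sup>2) \<le> ennreal ((1/4) ^ k)" if "N k \<le> m" "N k \<le> n" for k m n
  proof -
    have "(dist (X m) (X n))\<^sup>2 \<le> ((1/2) ^ k)\<^sup>2"
      using N[OF that] by (intro power_mono) auto
    then show ?thesis by (intro ennreal_leI) (simp only: half_power_square)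
  qed
  have conv: "AE x in lebesgue. convergent (\<lambda>k. g k x)"
  proof (rule AE_convergent_of_fast_Cauchy)
    show "(\<integral>\<^sup>+x. ennreal ((cmod (g (Suc k) x - g k x))\<^sup>2) \<partial>lebesgue) \<le> ennreal ((1/4) ^ k)" for k
      using sq[of k "r (Suc k)" "r k"] r by (simp add: g_def dist_l2_rep)
  qed simp
  define u where "u = (\<lambda>x. lim (\<lambda>k. g k x))"
  have [measurable]: "u \<in> borel_measurable lebesgue"
    unfolding u_def by (rule borel_measurable_lim_metric) simp
  have Fatou: "(\<integral>\<^sup>+x. ennreal ((cmod (rep_l2 (X m) x - u x))\<^sup>2) \<partial>lebesgue) \<le> ennreal ((1/4) ^ k)"
    if m: "N k \<le> m" for k m
  proof -
    have "(\<integral>\<^sup>+x. ennreal ((cmod (rep_l2 (X m) x - u x))\<^sup>2) \<partial>lebesgue)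
        = (\<integral>\<^sup>+x. liminf (\<lambda>j. ennreal ((cmod (rep_l2 (X m) x - g j x))\<^sup>2)) \<partial>lebesgue)"
    proof (rule nn_integral_cong_AE, use conv in eventually_elim)
      case (elim x)
      then have "(\<lambda>j. g j x) \<longlonglongrightarrow> u x" by (simp add: u_def convergent_LIMSEQ_iff)
      then have "(\<lambda>j. ennreal ((cmod (rep_l2 (X m) x - g j x))\<^sup>2))
          \<longlonglongrightarrow> ennreal ((cmod (rep_l2 (X m) x - u x))\<^sup>2)"
        by (intro tendsto_intros)
      then show ?case by (intro lim_imp_Liminf[symmetric]) simp_all
    qed
    also have "\<dots> \<le> liminf (\<lambda>j. \<integral>\<^sup>+x. ennreal ((cmod (rep_l2 (X m) x - g j x))\<^sup>2) \<partial>lebesgue)"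
      by (rule nn_integral_liminf) simp
    also have "\<dots> \<le> limsup (\<lambda>j. \<integral>\<^sup>+x. ennreal ((cmod (rep_l2 (X m) x - g j x))\<^sup>2) \<partial>lebesgue)"
      by (rule Liminf_le_Limsup) simp
    also have "\<dots> \<le> ennreal ((1/4) ^ k)"
    proof (rule Limsup_bounded)
      show "\<forall>\<^sub>F j in sequentially.
          (\<integral>\<^sup>+x. ennreal ((cmod (rep_l2 (X m) x - g j x))\<^sup>2) \<partial>lebesgue) \<le> ennreal ((1/4) ^ k)"
        using eventually_ge_at_top[of k]
        by eventually_elim (use sq[OF m r] in \<open>auto simp: g_def dist_l2_rep\<close>)
    qed
    finally show ?thesis .
  qed
  have "square_integrable (\<lambda>x. rep_l2 (X (N 0)) x - u x)"
    using Fatou[of 0 "N 0"] by (auto simp: square_integrable_iff intro: le_less_trans)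
  from square_integrable_diff[OF square_integrable_rep_l2[of "X (N 0)"] this]
  have u: "square_integrable u" by simp
  have "X \<longlonglongrightarrow> abs_l2 u"
  proof (rule metric_LIMSEQ_I)
    fix e :: real assume "0 < e"
    then obtain k where k: "(1/2) ^ k < e" using real_arch_pow_inv[of e "1/2"] by auto
    have "dist (X m) (abs_l2 u) < e" if "N k \<le> m" for m
    proof -
      have "ennreal ((dist (X m) (abs_l2 u))\<^sup>2) \<le> ennreal ((1/4) ^ k)"
        using Fatou[OF that] by (simp add: dist_abs_l2[OF u])
      then have "(dist (X m) (abs_l2 u))\<^sup>2 \<le> ((1/2) ^ k)\<^sup>2"
        by (simp add: half_power_square)
      then have "dist (X m) (abs_l2 u) \<le> (1/2) ^ k"
        by (rule power2_le_imp_le) simp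
      then show ?thesis using k by simp
    qed
    then show "\<exists>n0. \<forall>m\<ge>n0. dist (X m) (abs_l2 u) < e" by blast
  qed
  then show "convergent X" by (auto simp: convergent_def)
qed

section \<open>Polynomials in a positive operator\<close>

interpretation blinfun_compose: bounded_bilinear "(o\<^sub>L)"
  by (rule bounded_bilinear_blinfun_compose)

lemma blinfun_compose_id [simp]: "T o\<^sub>L id_blinfun = T" "id_blinfun o\<^sub>L T = T"
  by (auto intro: blinfun_eqI)

lemma blinfun_poly_eq_sum:
  assumes "degree q \<le> n"
  shows "blinfun_poly q B = (\<Sum>i\<le>n. coeff q i *\<^sub>R (((o\<^sub>L) B ^^ i) id_blinfun))"
  unfolding blinfun_poly_def using assms
  by (intro sum.mono_neutral_left) (auto simp: coeff_eq_0)

lemma blinfun_poly_0 [simp]: "blinfun_poly 0 B = 0"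
  by (simp add: blinfun_poly_def)

lemma blinfun_poly_pCons [simp]:
  "blinfun_poly (pCons a q) B = a *\<^sub>R id_blinfun + (B o\<^sub>L blinfun_poly q B)"
proof -
  have "blinfun_poly (pCons a q) B
      = (\<Sum>i\<le>Suc (degree q). coeff (pCons a q) i *\<^sub>R (((o\<^sub>L) B ^^ i) id_blinfun))"
    by (rule blinfun_poly_eq_sum) simp
  also have "\<dots> = a *\<^sub>R id_blinfun + (\<Sum>i\<le>degree q. coeff q i *\<^sub>R (B o\<^sub>L (((o\<^sub>L) B ^^ i) id_blinfun)))"
    by (simp add: sum.atMost_Suc_shift del: sum.atMost_Suc)
  also have "(\<Sum>i\<le>degree q. coeff q i *\<^sub>R (B o\<^sub>L (((o\<^sub>L) B ^^ i) id_blinfun))) = B o\<^sub>L blinfun_poly q B"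
    by (simp add: blinfun_poly_def blinfun_compose.sum_right blinfun_compose.scaleR_right)
  finally show ?thesis .
qed

lemma blinfun_poly_1 [simp]: "blinfun_poly 1 B = id_blinfun"
  by (simp add: one_pCons)

lemma blinfun_poly_add: "blinfun_poly (p + q) B = blinfun_poly p B + blinfun_poly q B"
proof (induction p arbitrary: q)
  case (pCons a p)
  then show ?case
    by (cases q) (simp add: scaleR_add_left blinfun_compose.add_right)
qed simp

lemma blinfun_poly_smult: "blinfun_poly (smult c p) B = c *\<^sub>R blinfun_poly p B"
  by (induction p) (simp_all add: scaleR_add_right blinfun_compose.scaleR_right)

lemma blinfun_poly_diff: "blinfun_poly (p - q) B = blinfun_poly p B - blinfun_poly q B"
  using blinfun_poly_add[of p "- q" B] blinfun_poly_smult[of "- 1" q B] by simp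

lemma blinfun_poly_sum: "blinfun_poly (\<Sum>i\<in>I. p i) B = (\<Sum>i\<in>I. blinfun_poly (p i) B)"
  by (induction I rule: infinite_finite_induct) (simp_all add: blinfun_poly_add)

lemma blinfun_poly_mult: "blinfun_poly (p * q) B = blinfun_poly p B o\<^sub>L blinfun_poly q B"
proof (induction p)
  case (pCons a p)
  have "blinfun_poly (pCons a p * q) B
      = a *\<^sub>R blinfun_poly q B + (B o\<^sub>L (blinfun_poly p B o\<^sub>L blinfun_poly q B))"
    by (simp add: mult_pCons_left blinfun_poly_add blinfun_poly_smult pCons.IH)
  then show ?case
    by (intro blinfun_eqI) (simp add: blinfun.add_left blinfun.scaleR_left)
qed simp

lemma blinfun_poly_pcompose: "blinfun_poly (pcompose p q) B = blinfun_poly p (blinfun_poly q B)"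
proof (induction p)
  case (pCons a p)
  then show ?case
    by (simp add: pcompose_pCons blinfun_poly_add blinfun_poly_mult)
qed simp

definition selfadjoint :: "('a::real_inner \<Rightarrow>\<^sub>L 'a) \<Rightarrow> bool" where
  "selfadjoint T \<longleftrightarrow> (\<forall>x y. inner (T x) y = inner x (T y))"

lemma selfadjoint_blinfun_poly:
  assumes "selfadjoint T"
  shows "selfadjoint (blinfun_poly p T)"
proof (induction p)
  case (pCons a p)
  have "blinfun_poly p T o\<^sub>L T = T o\<^sub>L blinfun_poly p T"
    using blinfun_poly_mult[of p "[:0, 1:]" T] blinfun_poly_mult[of "[:0, 1:]" p T]
    by (simp add: mult.commute[of p])
  then have "blinfun_poly p T (T y) = T (blinfun_poly p T y)" for y
    by (metis blinfun_apply_blinfun_compose)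
  then show ?case
    using assms pCons.IH
    by (simp add: selfadjoint_def blinfun.add_left blinfun.scaleR_left inner_add)
qed (simp add: selfadjoint_def)

definition positive_blinfun :: "('a::real_inner \<Rightarrow>\<^sub>L 'a) \<Rightarrow> bool" where
  "positive_blinfun T \<longleftrightarrow> selfadjoint T \<and> (\<forall>x. 0 \<le> inner (T x) x)"

lemma inner_blinfun_poly_square:
  assumes "selfadjoint T"
  shows "inner (blinfun_poly (p * p * q) T x) x
    = inner (blinfun_poly q T (blinfun_poly p T x)) (blinfun_poly p T x)"
proof -
  have "blinfun_poly (p * p * q) T x = blinfun_poly p T (blinfun_poly q T (blinfun_poly p T x))"
    by (simp add: mult.assoc blinfun_poly_mult mult.commute[of p q])
  then show ?thesis
    using selfadjoint_blinfun_poly[OF assms, of p] by (simp add: selfadjoint_def)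
qed

text \<open>
  Even powers can be moved to the other side of the inner product, so it is enough to treat exponents
  \<open>0\<close> and \<open>1\<close>. Writing \<open>X\<close> for the identity and \<open>Y\<close> for \<open>1 - X\<close>, the only case that is not immediate is
  \<open>X * Y\<close>, which equals \<open>Y\<^sup>2 * X + X\<^sup>2 * Y\<close> since \<open>X + Y = 1\<close>.
\<close>

lemma inner_Bernstein_nonneg:
  fixes T :: "'a::real_inner \<Rightarrow>\<^sub>L 'a"
  assumes T: "positive_blinfun T" and T1: "norm T \<le> 1"
  shows "0 \<le> inner (blinfun_poly ([:0, 1:] ^ k * [:1, -1:] ^ m) T x) x"
proof -
  let ?X = "[:0, 1:] :: real poly" and ?Y = "[:1, -1:] :: real poly"
  have sa: "selfadjoint T" and nonneg: "0 \<le> inner (T x) x" for x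
    using T by (auto simp: positive_blinfun_def)
  have X: "0 \<le> inner (blinfun_poly ?X T x) x" for x
    using nonneg by simp
  have Y: "0 \<le> inner (blinfun_poly ?Y T x) x" for x
  proof -
    have "inner (T x) x \<le> norm (T x) * norm x" by (rule norm_cauchy_schwarz)
    also have "\<dots> \<le> 1 * norm x * norm x"
      using norm_blinfun[of T x] mult_right_mono[OF T1, of "norm x"]
      by (intro mult_right_mono) auto
    finally show ?thesis
      by (simp add: blinfun.add_left blinfun.minus_left blinfun.minus_right inner_add_left inner_diff_left
          power2_norm_eq_inner[symmetric] power2_eq_square)
  qed
  have XY: "0 \<le> inner (blinfun_poly (?X * ?Y) T x) x" for x
  proof -
    have "?X * ?Y = ?Y * ?Y * ?X + ?X * ?X * ?Y" by simp
    then show ?thesis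
      using X Y
      by (simp only: blinfun_poly_add blinfun.add_left inner_add_left
          inner_blinfun_poly_square[OF sa] add_nonneg_nonneg)
  qed
  have reduced: "0 \<le> inner (blinfun_poly (?X ^ (k mod 2) * ?Y ^ (m mod 2)) T x) x" for x
    using X[of x] Y[of x] XY[of x]
    by (cases "even k"; cases "even m") (simp_all only: even_iff_mod_2_eq_zero odd_iff_mod_2_eq_one, auto)
  have split: "q ^ j = q ^ (j div 2) * q ^ (j div 2) * q ^ (j mod 2)" for q :: "real poly" and j
    by (simp add: power_add[symmetric] mult_2[symmetric])
  have "?X ^ k * ?Y ^ m
      = (?X ^ (k div 2) * ?Y ^ (m div 2)) * (?X ^ (k div 2) * ?Y ^ (m div 2))
        * (?X ^ (k mod 2) * ?Y ^ (m mod 2))"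
    by (subst split[of ?X k], subst split[of ?Y m]) (simp only: mult_ac)
  then show ?thesis
    using reduced by (simp only: inner_blinfun_poly_square[OF sa])
qed

text \<open>
  The quotient of binomial coefficients is the product of the factors \<open>(k - j) / (n - j)\<close> for \<open>j < i\<close>,
  each of which is close to \<open>k / n\<close>, uniformly in \<open>k\<close>.
\<close>

lemma binomial_ratio_approx:
  fixes n k i d :: nat
  assumes "k \<le> n" "i \<le> d" "2 * d < n"
  shows "\<bar>real (k choose i) / real (n choose i) - (real k / real n) ^ i\<bar> \<le> d * (d / (n - d))"
proof -
  have ratio: "real (k choose i) / real (n choose i) = (\<Prod>j<i. (real k - real j) / (real n - real j))"
    by (simp add: binomial_gbinomial gbinomial_prod_rev prod_dividef lessThan_atLeast0)
  \<comment> \<open>The hypothesis \<open>2 * d < n\<close> bounds the factors with \<open>k < j\<close>, which are negative.\<close>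
  have bnd: "\<bar>(real k - real j) / (real n - real j)\<bar> \<le> 1" if "j < i" for j
    using assms that by (auto simp: abs_le_iff divide_simps)
  have diff: "\<bar>(real k - real j) / (real n - real j) - real k / real n\<bar> \<le> d / (n - d)" if "j < i" for j
  proof -
    have pos: "0 < real n - real j" "0 < real n - real d" "0 < real n" and jd: "real j \<le> d"
      using assms that by auto
    have "(real k - real j) / (real n - real j) - real k / real n
        = - (real j / (real n - real j) * ((real n - real k) / real n))"
      using pos by (simp add: field_simps)
    also have "\<bar>\<dots>\<bar> = real j / (real n - real j) * ((real n - real k) / real n)"
      using pos assms by simp
    also have "\<dots> \<le> real j / (real n - real j) * 1"
      using pos assms by (intro mult_left_mono) auto
    also have "\<dots> \<le> real d / (real n - real d)"
      using pos jd by (auto intro!: frac_le)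
    finally show ?thesis using assms by (simp add: of_nat_diff)
  qed
  have "\<bar>(\<Prod>j<i. (real k - real j) / (real n - real j)) - (\<Prod>j<i. real k / real n)\<bar>
      \<le> (\<Sum>j<i. \<bar>(real k - real j) / (real n - real j) - real k / real n\<bar>)"
    using norm_prod_diff[of "{..<i}" "\<lambda>j. (real k - real j) / (real n - real j)" "\<lambda>j. real k / real n"]
      bnd assms by (simp add: divide_le_eq)
  also have "\<dots> \<le> (\<Sum>j<i. d / (n - d))"
    by (intro sum_mono diff) simp
  also have "\<dots> \<le> d * (d / (n - d))"
    using assms by (simp, intro divide_right_mono mult_right_mono) auto
  finally show ?thesis by (simp add: ratio)
qed

lemma smult_sum_right: "smult c (\<Sum>i\<in>I. p i) = (\<Sum>i\<in>I. smult c (p i))"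
  by (induction I rule: infinite_finite_induct) (simp_all add: smult_add_right)

text \<open>
  The expansion of a polynomial in the Bernstein basis of degree \<open>n\<close>: every monomial \<open>X ^ i\<close> is
  multiplied by \<open>(X + Y) ^ (n - i) = 1\<close> with \<open>Y = 1 - X\<close>. By \<open>binomial_ratio_approx\<close>
  the coefficient at index \<open>k\<close>, divided by the binomial coefficient, is approximately the value of the polynomial at \<open>k / n\<close>.
\<close>

lemma poly_eq_Bernstein_form:
  fixes p :: "real poly"
  assumes "degree p \<le> n"
  shows "p = (\<Sum>k\<le>n. smult (real (n choose k) *
      (\<Sum>i\<le>degree p. coeff p i * (real (k choose i) / real (n choose i)))) ([:0, 1:] ^ k * [:1, -1:] ^ (n - k)))"
proof -
  let ?X = "[:0, 1:] :: real poly" and ?Y = "[:1, -1:] :: real poly"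
  have XY: "?X + ?Y = 1" by (simp add: one_pCons)
  have mono: "?X ^ i = (\<Sum>k\<le>n. smult (real (n choose k) * (real (k choose i) / real (n choose i)))
      (?X ^ k * ?Y ^ (n - k)))" if "i \<le> n" for i
  proof -
    have "?X ^ i = ?X ^ i * (?X + ?Y) ^ (n - i)" by (simp only: XY power_one mult_1_right)
    also have "\<dots> = (\<Sum>j\<le>n - i. ?X ^ i * (of_nat (n - i choose j) * ?X ^ j * ?Y ^ (n - i - j)))"
      by (simp only: binomial_ring sum_distrib_left)
    also have "\<dots> = (\<Sum>j\<le>n - i. smult (real (n - i choose j)) (?X ^ (i + j) * ?Y ^ (n - (i + j))))"
    proof (intro sum.cong refl)
      fix j
      have "?X ^ i * (of_nat (n - i choose j) * ?X ^ j * ?Y ^ (n - i - j))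
          = of_nat (n - i choose j) * (?X ^ (i + j) * ?Y ^ (n - (i + j)))"
        by (simp only: power_add diff_diff_left mult_ac)
      then show "?X ^ i * (of_nat (n - i choose j) * ?X ^ j * ?Y ^ (n - i - j))
          = smult (real (n - i choose j)) (?X ^ (i + j) * ?Y ^ (n - (i + j)))"
        by (simp add: of_nat_poly)
    qed
    also have "\<dots> = (\<Sum>k\<in>{i..n}. smult (real (n - i choose (k - i))) (?X ^ k * ?Y ^ (n - k)))"
      using that by (intro sum.reindex_bij_witness[of _ "\<lambda>k. k - i" "\<lambda>j. i + j"]) auto
    also have "\<dots> = (\<Sum>k\<in>{i..n}. smult (real (n choose k) * (real (k choose i) / real (n choose i)))
        (?X ^ k * ?Y ^ (n - k)))"
    proof (intro sum.cong refl)
      fix k assume k: "k \<in> {i..n}"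
      have "real (n choose k) * real (k choose i) = real (n choose i) * real (n - i choose (k - i))"
        using choose_mult[of i k n] k by (metis atLeastAtMost_iff of_nat_mult)
      moreover have "real (n choose i) \<noteq> 0" using that by simp
      ultimately have "real (n - i choose (k - i)) = real (n choose k) * (real (k choose i) / real (n choose i))"
        by (simp add: field_simps)
      then show "smult (real (n - i choose (k - i))) (?X ^ k * ?Y ^ (n - k))
        = smult (real (n choose k) * (real (k choose i) / real (n choose i))) (?X ^ k * ?Y ^ (n - k))"
        by simp
    qed
    also have "\<dots> = (\<Sum>k\<le>n. smult (real (n choose k) * (real (k choose i) / real (n choose i)))
        (?X ^ k * ?Y ^ (n - k)))"
      by (intro sum.mono_neutral_left) (auto simp: binomial_eq_0)
    finally show ?thesis .
  qed
  have "p = (\<Sum>i\<le>degree p. smult (coeff p i) (?X ^ i))"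
    using poly_as_sum_of_monoms[of p] by (simp add: monom_altdef)
  also have "\<dots> = (\<Sum>i\<le>degree p. \<Sum>k\<le>n. smult (real (n choose k) *
      (coeff p i * (real (k choose i) / real (n choose i)))) (?X ^ k * ?Y ^ (n - k)))"
    using assms by (intro sum.cong refl, subst mono) (auto simp: smult_sum_right mult.left_commute)
  also have "\<dots> = (\<Sum>k\<le>n. \<Sum>i\<le>degree p. smult (real (n choose k) *
      (coeff p i * (real (k choose i) / real (n choose i)))) (?X ^ k * ?Y ^ (n - k)))"
    by (rule sum.swap)
  finally show ?thesis
    by (simp only: sum_distrib_left smult_sum)
qed

text \<open>
  A theorem of Bernstein: a polynomial that is strictly positive on the unit interval has nonnegative
  Bernstein coefficients once the degree \<open>n\<close> of the basis is large, because these coefficients approximate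
  its values uniformly. It certifies positivity in a form that can be evaluated at an operator.
\<close>

lemma positive_poly_Bernstein:
  fixes p :: "real poly"
  assumes pos: "\<And>t. 0 \<le> t \<Longrightarrow> t \<le> 1 \<Longrightarrow> 0 < poly p t"
  shows "\<exists>n b. (\<forall>k\<le>n. 0 \<le> b k)
    \<and> p = (\<Sum>k\<le>n. smult (b k) ([:0, 1:] ^ k * [:1, -1:] ^ (n - k)))"
proof -
  have "\<exists>t\<in>{0..1::real}. \<forall>s\<in>{0..1}. poly p t \<le> poly p s"
    by (intro continuous_attains_inf) (auto intro: continuous_intros)
  then obtain e where e: "0 < e" "\<And>t. 0 \<le> t \<Longrightarrow> t \<le> 1 \<Longrightarrow> e \<le> poly p t"
    using pos by (metis atLeastAtMost_iff)
  define d where "d = degree p"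
  define S where "S = (\<Sum>i\<le>d. \<bar>coeff p i\<bar>)"
  \<comment> \<open>The choice of \<open>m\<close> makes the total error of the coefficients at most the minimum \<open>e\<close> of the polynomial.\<close>
  obtain m :: nat where m: "S * (d * d) / e < m" using reals_Archimedean2 by blast
  define n where "n = 2 * d + 1 + m"
  have n: "2 * d < n" by (simp add: n_def)
  have "S * (d * d) \<le> e * real (n - d)"
  proof -
    have "S * (d * d) \<le> e * m" using m e by (simp add: divide_less_eq mult.commute)
    also have "\<dots> \<le> e * real (n - d)" using e by (simp add: n_def)
    finally show ?thesis .
  qed
  then have small: "S * (d * (d / (n - d))) \<le> e"
    using n by (simp add: divide_le_eq)
  define \<rho> where "\<rho> = (\<lambda>k. \<Sum>i\<le>d. coeff p i * (real (k choose i) / real (n choose i)))"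
  have nonneg: "0 \<le> real (n choose k) * \<rho> k" if "k \<le> n" for k
  proof -
    have "poly p (k / n) - \<rho> k
        = (\<Sum>i\<le>d. coeff p i * ((real k / real n) ^ i - real (k choose i) / real (n choose i)))"
      by (simp add: poly_altdef \<rho>_def d_def sum_subtractf right_diff_distrib)
    also have "\<dots> \<le> (\<Sum>i\<le>d. \<bar>coeff p i\<bar> * (d * (d / (n - d))))"
    proof (intro sum_mono)
      fix i assume "i \<in> {..d}"
      then have "\<bar>(real k / real n) ^ i - real (k choose i) / real (n choose i)\<bar> \<le> d * (d / (n - d))"
        using binomial_ratio_approx[OF that _ n, of i] by (simp add: abs_minus_commute)
      then have "\<bar>coeff p i * ((real k / real n) ^ i - real (k choose i) / real (n choose i))\<bar>
          \<le> \<bar>coeff p i\<bar> * (d * (d / (n - d)))"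
        unfolding abs_mult by (rule mult_left_mono) simp
      then show "coeff p i * ((real k / real n) ^ i - real (k choose i) / real (n choose i))
          \<le> \<bar>coeff p i\<bar> * (d * (d / (n - d)))" by (rule abs_le_D1)
    qed
    also have "\<dots> = S * (d * (d / (n - d)))" by (simp only: S_def sum_distrib_right)
    also have "\<dots> \<le> e" by (rule small)
    also have "e \<le> poly p (k / n)" using that n by (intro e) auto
    finally show ?thesis by simp
  qed
  have "p = (\<Sum>k\<le>n. smult (real (n choose k) * \<rho> k) ([:0, 1:] ^ k * [:1, -1:] ^ (n - k)))"
    unfolding \<rho>_def d_def using n by (intro poly_eq_Bernstein_form) (simp add: d_def)
  with nonneg have "(\<forall>k\<le>n. 0 \<le> real (n choose k) * \<rho> k)
      \<and> p = (\<Sum>k\<le>n. smult (real (n choose k) * \<rho> k) ([:0, 1:] ^ k * [:1, -1:] ^ (n - k)))"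
    by (intro conjI allI impI)
  then show ?thesis by (intro exI)
qed

text \<open>
  Adding a small constant makes the polynomial strictly positive, so that it is a nonnegative
  combination of Bernstein polynomials, which are positive at \<open>T\<close>.
\<close>

lemma inner_blinfun_poly_nonneg_unit:
  fixes T :: "'a::real_inner \<Rightarrow>\<^sub>L 'a"
  assumes T: "positive_blinfun T" "norm T \<le> 1"
    and p: "\<And>t. 0 \<le> t \<Longrightarrow> t \<le> 1 \<Longrightarrow> 0 \<le> poly p t"
  shows "0 \<le> inner (blinfun_poly p T x) x"
proof (rule field_le_epsilon)
  fix e :: real assume "0 < e"
  define e' where "e' = e / (inner x x + 1)"
  have pos: "0 < inner x x + 1" by (simp add: add_nonneg_pos)
  have "0 < e'" using \<open>0 < e\<close> pos by (simp add: e'_def)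
  then have posq: "0 < poly (p + [:e':]) t" if "0 \<le> t" "t \<le> 1" for t
    using p[OF that] by simp
  have "\<exists>n b. (\<forall>k\<le>n. 0 \<le> b k)
      \<and> p + [:e':] = (\<Sum>k\<le>n. smult (b k) ([:0, 1:] ^ k * [:1, -1:] ^ (n - k)))"
    by (rule positive_poly_Bernstein) (rule posq)
  then obtain n b where b: "\<forall>k\<le>n. 0 \<le> b k"
    and eq: "p + [:e':] = (\<Sum>k\<le>n. smult (b k) ([:0, 1:] ^ k * [:1, -1:] ^ (n - k)))"
    by (elim exE conjE)
  have "inner (blinfun_poly (p + [:e':]) T x) x
      = (\<Sum>k\<le>n. b k * inner (blinfun_poly ([:0, 1:] ^ k * [:1, -1:] ^ (n - k)) T x) x)"
    by (simp only: eq blinfun_poly_sum blinfun_poly_smult blinfun.sum_left blinfun.scaleR_left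
        inner_sum_left inner_scaleR_left)
  also have "\<dots> \<ge> 0"
    by (intro sum_nonneg mult_nonneg_nonneg b[rule_format] inner_Bernstein_nonneg T) auto
  finally have "0 \<le> inner (blinfun_poly p T x) x + e' * inner x x"
    by (simp add: blinfun_poly_add blinfun.add_left blinfun.scaleR_left inner_add_left)
  moreover have "e' * inner x x \<le> e"
    using pos \<open>0 < e\<close> by (simp add: e'_def divide_le_eq mult_left_mono)
  ultimately show "0 \<le> inner (blinfun_poly p T x) x + e" by linarith
qed

text \<open>
  The general interval is reduced to the unit interval by the substitution \<open>t \<mapsto> norm B * t\<close>. For
  \<open>B = 0\<close> the rescaled operator is \<open>0\<close> as well, since \<open>inverse 0 = 0\<close>.
\<close>

lemma inner_blinfun_poly_nonneg:
  fixes B :: "'a::real_inner \<Rightarrow>\<^sub>L 'a"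
  assumes B: "positive_blinfun B"
    and p: "\<And>t. t \<in> {0..norm B} \<Longrightarrow> 0 \<le> poly p t"
  shows "0 \<le> inner (blinfun_poly p B x) x"
proof -
  define T where "T = inverse (norm B) *\<^sub>R B"
  have T: "positive_blinfun T" "norm T \<le> 1"
    using B by (auto simp: T_def positive_blinfun_def selfadjoint_def blinfun.scaleR_left field_simps)
  have "norm B *\<^sub>R T = B" by (cases "B = 0") (auto simp: T_def)
  then have "blinfun_poly (pcompose p [:0, norm B:]) T = blinfun_poly p B"
    by (simp add: blinfun_poly_pcompose blinfun_compose.scaleR_right)
  moreover have "0 \<le> inner (blinfun_poly (pcompose p [:0, norm B:]) T x) x"
    by (rule inner_blinfun_poly_nonneg_unit[OF T]) (auto simp: poly_pcompose intro!: p mult_left_le_one_le)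
  ultimately show ?thesis by simp
qed

text \<open>
  Applying positivity to \<open>c\<^sup>2 - p\<^sup>2\<close> bounds \<open>(norm (p(B) x))\<^sup>2 = inner (p\<^sup>2(B) x) x\<close>.
\<close>

lemma norm_blinfun_poly_le:
  fixes B :: "'a::real_inner \<Rightarrow>\<^sub>L 'a"
  assumes B: "positive_blinfun B" and c: "0 \<le> c"
    and p: "\<And>t. t \<in> {0..norm B} \<Longrightarrow> \<bar>poly p t\<bar> \<le> c"
  shows "norm (blinfun_poly p B) \<le> c"
proof (rule norm_blinfun_bound[OF c])
  fix x
  have "0 \<le> inner (blinfun_poly ([:c\<^sup>2:] - p * p) B x) x"
  proof (rule inner_blinfun_poly_nonneg[OF B])
    show "0 \<le> poly ([:c\<^sup>2:] - p * p) t" if "t \<in> {0..norm B}" for t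
      using power_mono[OF p[OF that], of 2] by (simp add: power2_eq_square)
  qed
  moreover have "inner (blinfun_poly (p * p) B x) x = (norm (blinfun_poly p B x))\<^sup>2"
    using inner_blinfun_poly_square[of B p 1 x] B
    by (simp add: positive_blinfun_def power2_norm_eq_inner)
  ultimately have "(norm (blinfun_poly p B x))\<^sup>2 \<le> (c * norm x)\<^sup>2"
    by (simp add: blinfun_poly_diff blinfun.diff_left blinfun.scaleR_left inner_diff_left
        power_mult_distrib power2_norm_eq_inner)
  then show "norm (blinfun_poly p B x) \<le> c * norm x"
    by (rule power2_le_imp_le) (use c in simp)
qed

section \<open>The continuous functional calculus\<close>

lemma uniform_limit_poly_exists:
  fixes g :: "real \<Rightarrow> real"
  assumes "continuous_on {a..b} g"
  shows "\<exists>q. uniform_limit {a..b} (\<lambda>k t. poly (q k) t) g sequentially"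
proof -
  have "\<exists>p :: real poly. \<forall>t\<in>{a..b}. \<bar>g t - poly p t\<bar> < inverse (Suc k)" for k
  proof -
    obtain P where "real_polynomial_function P" and P: "\<And>t. t \<in> {a..b} \<Longrightarrow> \<bar>g t - P t\<bar> < inverse (Suc k)"
      using Stone_Weierstrass_real_polynomial_function[OF compact_Icc assms, of "inverse (Suc k)"]
      by auto
    then obtain c n where "P = (\<lambda>t. \<Sum>i\<le>n. c i * t ^ i)"
      unfolding real_polynomial_function_iff_sum by blast
    then have "poly (\<Sum>i\<le>n. monom (c i) i) t = P t" for t
      by (simp add: poly_sum poly_monom)
    with P show ?thesis by metis
  qed
  then obtain q :: "nat \<Rightarrow> real poly"
    where q: "\<And>k t. t \<in> {a..b} \<Longrightarrow> \<bar>g t - poly (q k) t\<bar> < inverse (Suc k)"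
    by metis
  have "uniform_limit {a..b} (\<lambda>k t. poly (q k) t) g sequentially"
  proof (rule uniform_limitI)
    fix e :: real assume "0 < e"
    then obtain N where N: "inverse (real (Suc N)) < e" using reals_Archimedean by auto
    show "\<forall>\<^sub>F k in sequentially. \<forall>t\<in>{a..b}. dist (poly (q k) t) (g t) < e"
      using eventually_ge_at_top[of N]
    proof eventually_elim
      case (elim k)
      then have "inverse (real (Suc k)) \<le> inverse (real (Suc N))" by (auto intro!: le_imp_inverse_le)
      then have small: "inverse (real (Suc k)) < e" using N by (rule le_less_trans)
      show ?case
      proof
        fix t assume "t \<in> {a..b}"
        then have "dist (g t) (poly (q k) t) < e"
          unfolding dist_real_def using small by (rule less_trans[OF q])
        then show "dist (poly (q k) t) (g t) < e" by (simp only: dist_commute)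
      qed
    qed
  qed
  then show ?thesis by (intro exI[of _ q])
qed

lemma blinfun_poly_diff_tendsto_0:
  fixes B :: "'a::real_inner \<Rightarrow>\<^sub>L 'a"
  assumes B: "positive_blinfun B"
    and p: "uniform_limit {0..norm B} (\<lambda>k t. poly (p k) t) g sequentially"
    and q: "uniform_limit {0..norm B} (\<lambda>k t. poly (q k) t) g sequentially"
    and "0 < e"
  shows "\<exists>N. \<forall>m\<ge>N. \<forall>n\<ge>N. norm (blinfun_poly (p m) B - blinfun_poly (q n) B) < e"
proof -
  have "\<forall>\<^sub>F k in sequentially. (\<forall>t\<in>{0..norm B}. dist (poly (p k) t) (g t) < e / 4)
      \<and> (\<forall>t\<in>{0..norm B}. dist (poly (q k) t) (g t) < e / 4)"
    using uniform_limitD[OF p, of "e / 4"] uniform_limitD[OF q, of "e / 4"] \<open>0 < e\<close>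
    by (auto intro: eventually_conj)
  then obtain N where N: "\<And>k t. N \<le> k \<Longrightarrow> t \<in> {0..norm B} \<Longrightarrow> dist (poly (p k) t) (g t) < e / 4"
      "\<And>k t. N \<le> k \<Longrightarrow> t \<in> {0..norm B} \<Longrightarrow> dist (poly (q k) t) (g t) < e / 4"
    unfolding eventually_sequentially by blast
  have "norm (blinfun_poly (p m) B - blinfun_poly (q n) B) < e" if "N \<le> m" "N \<le> n" for m n
  proof -
    have "norm (blinfun_poly (p m - q n) B) \<le> e / 2"
    proof (rule norm_blinfun_poly_le[OF B])
      show "\<bar>poly (p m - q n) t\<bar> \<le> e / 2" if "t \<in> {0..norm B}" for t
        using N(1)[OF \<open>N \<le> m\<close> that] N(2)[OF \<open>N \<le> n\<close> that]
        unfolding dist_real_def poly_diff by argo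
    qed (use \<open>0 < e\<close> in simp)
    then show ?thesis using \<open>0 < e\<close> by (simp add: blinfun_poly_diff)
  qed
  then show ?thesis by blast
qed

text \<open>
  The norm bound makes the values at \<open>B\<close> of any uniformly convergent sequence of polynomials a Cauchy
  sequence and shows that the limit depends only on the limit function. The Weierstrass theorem supplies
  at least one such sequence, so the operator described by \<open>fun_calc\<close> exists and is unique.
\<close>

lemma fun_calc_limit:
  fixes B :: "'a::{real_inner, banach} \<Rightarrow>\<^sub>L 'a"
  assumes B: "positive_blinfun B" and g: "continuous_on {0..norm B} g"
    and q: "uniform_limit {0..norm B} (\<lambda>k t. poly (q k) t) g sequentially"
  shows "(\<lambda>k. blinfun_poly (q k) B) \<longlonglongrightarrow> fun_calc g B"
proof -
  obtain q0 :: "nat \<Rightarrow> real poly" where q0: "uniform_limit {0..norm B} (\<lambda>k t. poly (q0 k) t) g sequentially"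
    using uniform_limit_poly_exists[OF g] by (elim exE)
  have "Cauchy (\<lambda>k. blinfun_poly (q0 k) B)"
    unfolding Cauchy_def dist_norm using blinfun_poly_diff_tendsto_0[OF B q0 q0] by (intro allI impI)
  then obtain C where C: "(\<lambda>k. blinfun_poly (q0 k) B) \<longlonglongrightarrow> C"
    using Cauchy_convergent convergent_def by blast
  have lim: "(\<lambda>k. blinfun_poly (p k) B) \<longlonglongrightarrow> C"
    if p: "uniform_limit {0..norm B} (\<lambda>k t. poly (p k) t) g sequentially" for p
  proof -
    have "(\<lambda>k. blinfun_poly (p k) B - blinfun_poly (q0 k) B) \<longlonglongrightarrow> 0"
    proof (rule LIMSEQ_I)
      fix e :: real assume "0 < e"
      obtain N where "\<forall>m\<ge>N. \<forall>n\<ge>N. norm (blinfun_poly (p m) B - blinfun_poly (q0 n) B) < e"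
        using blinfun_poly_diff_tendsto_0[OF B p q0 \<open>0 < e\<close>] by (elim exE)
      then show "\<exists>N. \<forall>k\<ge>N. norm (blinfun_poly (p k) B - blinfun_poly (q0 k) B - 0) < e"
        by (auto intro!: exI[of _ N])
    qed
    from tendsto_add[OF this C] show ?thesis by simp
  qed
  have "fun_calc g B = C"
    unfolding fun_calc_def
  proof (rule the_equality)
    show "C' = C" if "\<forall>q. uniform_limit {0..norm B} (\<lambda>k t. poly (q k) t) g sequentially
        \<longrightarrow> (\<lambda>k. blinfun_poly (q k) B) \<longlonglongrightarrow> C'" for C'
      using that[rule_format, OF q0] C by (rule LIMSEQ_unique)
  qed (use lim in simp)
  then show ?thesis using lim[OF q] by simp
qed

text \<open>
  Linearity and positivity of the functional calculus in one statement: a pointwise linear inequality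
  between three functions passes to the quadratic forms. With two vanishing coefficients it expresses
  positivity; with \<open>c = - 1\<close> it bounds one function by a combination of two others.
\<close>

lemma fun_calc_combination_nonneg:
  fixes B :: "'a::{real_inner, banach} \<Rightarrow>\<^sub>L 'a"
  assumes B: "positive_blinfun B"
    and cont: "continuous_on {0..norm B} f" "continuous_on {0..norm B} g" "continuous_on {0..norm B} h"
    and nonneg: "\<And>t. t \<in> {0..norm B} \<Longrightarrow> 0 \<le> a * f t + b * g t + c * h t"
  shows "0 \<le> a * inner (fun_calc f B x) x + b * inner (fun_calc g B x) x + c * inner (fun_calc h B x) x"
proof -
  obtain p q r :: "nat \<Rightarrow> real poly" where
    lim: "uniform_limit {0..norm B} (\<lambda>k t. poly (p k) t) f sequentially"
      "uniform_limit {0..norm B} (\<lambda>k t. poly (q k) t) g sequentially"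
      "uniform_limit {0..norm B} (\<lambda>k t. poly (r k) t) h sequentially"
    using uniform_limit_poly_exists[OF cont(1)] uniform_limit_poly_exists[OF cont(2)]
      uniform_limit_poly_exists[OF cont(3)] by (elim exE)
  define s where "s = (\<lambda>k. smult a (p k) + smult b (q k) + smult c (r k))"
  have s: "uniform_limit {0..norm B} (\<lambda>k t. poly (s k) t) (\<lambda>t. a * f t + b * g t + c * h t) sequentially"
    unfolding s_def poly_add poly_smult
    by (rule uniform_limit_add[OF uniform_limit_add[OF
          bounded_linear.uniform_limit[OF bounded_linear_mult_right lim(1)]
          bounded_linear.uniform_limit[OF bounded_linear_mult_right lim(2)]]
          bounded_linear.uniform_limit[OF bounded_linear_mult_right lim(3)]])
  have conv: "(\<lambda>k. inner (blinfun_poly (s k) B x) x) \<longlonglongrightarrow>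
      inner ((a *\<^sub>R fun_calc f B + b *\<^sub>R fun_calc g B + c *\<^sub>R fun_calc h B) x) x"
    unfolding s_def blinfun_poly_add blinfun_poly_smult
    by (intro tendsto_intros fun_calc_limit[OF B cont(1) lim(1)] fun_calc_limit[OF B cont(2) lim(2)]
        fun_calc_limit[OF B cont(3) lim(3)])
  have lower: "- (e * inner x x) \<le> inner (blinfun_poly (s k) B x) x"
    if "\<forall>t\<in>{0..norm B}. dist (poly (s k) t) (a * f t + b * g t + c * h t) < e" for k e
  proof -
    have "0 \<le> inner (blinfun_poly (s k + [:e:]) B x) x"
    proof (rule inner_blinfun_poly_nonneg[OF B])
      fix t assume t: "t \<in> {0..norm B}"
      then have "\<bar>poly (s k) t - (a * f t + b * g t + c * h t)\<bar> < e"
        using that by (simp add: dist_real_def)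
      then show "0 \<le> poly (s k + [:e:]) t" using nonneg[OF t] by simp
    qed
    then show ?thesis
      by (simp add: blinfun_poly_add blinfun.add_left blinfun.scaleR_left inner_add_left)
  qed
  have ev: "\<forall>\<^sub>F k in sequentially. - (e * inner x x) \<le> inner (blinfun_poly (s k) B x) x" if "0 < e" for e
    by (rule eventually_mono[OF uniform_limitD[OF s that] lower])
  have le: "- (e * inner x x) \<le> inner ((a *\<^sub>R fun_calc f B + b *\<^sub>R fun_calc g B + c *\<^sub>R fun_calc h B) x) x"
    if "0 < e" for e
    by (rule tendsto_lowerbound[OF conv ev[OF that]]) simp
  have "((\<lambda>e. - (e * inner x x)) \<longlongrightarrow> - (0 * inner x x)) (at_right (0::real))"
    by (intro tendsto_intros)
  then have "- (0 * inner x x) \<le> inner ((a *\<^sub>R fun_calc f B + b *\<^sub>R fun_calc g B + c *\<^sub>R fun_calc h B) x) x"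
    by (rule tendsto_upperbound) (use le in \<open>auto simp: eventually_at_filter\<close>)
  then show ?thesis
    by (simp add: blinfun.add_left blinfun.scaleR_left inner_add_left)
qed

lemma positive_fun_calc:
  fixes B :: "'a::{real_inner, banach} \<Rightarrow>\<^sub>L 'a"
  assumes B: "positive_blinfun B" and g: "continuous_on {0..norm B} g"
    and nonneg: "\<And>t. t \<in> {0..norm B} \<Longrightarrow> 0 \<le> g t"
  shows "positive_blinfun (fun_calc g B)"
proof -
  obtain q where q: "uniform_limit {0..norm B} (\<lambda>k t. poly (q k) t) g sequentially"
    using uniform_limit_poly_exists[OF g] by (elim exE)
  note lim = fun_calc_limit[OF B g q]
  have "inner (fun_calc g B x) y = inner x (fun_calc g B y)" for x y
  proof (rule LIMSEQ_unique)
    show "(\<lambda>k. inner (blinfun_poly (q k) B x) y) \<longlonglongrightarrow> inner (fun_calc g B x) y"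
      by (intro tendsto_intros lim)
    have "inner (blinfun_poly (q k) B x) y = inner x (blinfun_poly (q k) B y)" for k
      using selfadjoint_blinfun_poly[of B "q k"] B by (simp add: positive_blinfun_def selfadjoint_def)
    then show "(\<lambda>k. inner (blinfun_poly (q k) B x) y) \<longlonglongrightarrow> inner x (fun_calc g B y)"
      by (simp only:) (intro tendsto_intros lim)
  qed
  moreover have "0 \<le> inner (fun_calc g B x) x" for x
    using fun_calc_combination_nonneg[OF B g g g, of 1 0 0] nonneg by simp
  ultimately show ?thesis by (simp add: positive_blinfun_def selfadjoint_def)
qed

lemma norm_fun_calc_le:
  fixes B :: "'a::{real_inner, banach} \<Rightarrow>\<^sub>L 'a"
  assumes B: "positive_blinfun B" and g: "continuous_on {0..norm B} g"
    and c: "\<And>t. t \<in> {0..norm B} \<Longrightarrow> \<bar>g t\<bar> \<le> c"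
  shows "norm (fun_calc g B) \<le> c"
proof (rule field_le_epsilon)
  fix e :: real assume "0 < e"
  obtain q where q: "uniform_limit {0..norm B} (\<lambda>k t. poly (q k) t) g sequentially"
    using uniform_limit_poly_exists[OF g] by (elim exE)
  have "0 \<le> c" using c[of 0] by simp
  have "\<forall>\<^sub>F k in sequentially. norm (blinfun_poly (q k) B) \<le> c + e"
    using uniform_limitD[OF q \<open>0 < e\<close>]
  proof eventually_elim
    case (elim k)
    show ?case
    proof (rule norm_blinfun_poly_le[OF B])
      show "\<bar>poly (q k) t\<bar> \<le> c + e" if "t \<in> {0..norm B}" for t
        using c[OF that] elim[rule_format, OF that] by (simp add: dist_real_def)
    qed (use \<open>0 \<le> c\<close> \<open>0 < e\<close> in simp)
  qed
  then show "norm (fun_calc g B) \<le> c + e"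
    by (rule tendsto_upperbound[OF tendsto_norm[OF fun_calc_limit[OF B g q]]]) simp
qed

section \<open>Absolute values and traces of powers\<close>

lemma l2_cinner_scaleC_left: "l2_cinner (l2_scaleC c f) g = c * l2_cinner f g"
  by transfer (simp add: l2_eq_def mult.assoc)

lemma Im_l2_cinner: "Im (l2_cinner f g) = inner (l2_scaleC (- \<i>) f) g"
  by (simp add: inner_l2_def l2_cinner_scaleC_left)

text \<open>
  The imaginary part of the complex inner product is a real inner product with a vector multiplied by
  \<open>- \<i>\<close>, which a complex linear operator commutes with. Hence the complex and the real adjoint relation agree.
\<close>

lemma l2_cinner_adjoint_iff:
  assumes "complex_linear A"
  shows "(\<forall>f g. l2_cinner (blinfun_apply A f) g = l2_cinner f (blinfun_apply B g))
    \<longleftrightarrow> (\<forall>f g. inner (blinfun_apply A f) g = inner f (blinfun_apply B g))"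
proof
  assume real: "\<forall>f g. inner (A f) g = inner f (B g)"
  have "Im (l2_cinner (A f) g) = Im (l2_cinner f (B g))" for f g
    using assms real unfolding Im_l2_cinner complex_linear_def by metis
  moreover have "Re (l2_cinner (A f) g) = Re (l2_cinner f (B g))" for f g
    using real by (simp add: inner_l2_def)
  ultimately show "\<forall>f g. l2_cinner (A f) g = l2_cinner f (B g)"
    by (simp add: complex_eq_iff)
qed (simp add: inner_l2_def)

lemma
  assumes A: "complex_linear A"
  shows inner_l2_adjoint: "inner (blinfun_apply A f) g = inner f (blinfun_apply (l2_adjoint A) g)"
    and norm_l2_adjoint_le: "norm (l2_adjoint A) \<le> norm A"
proof -
  obtain B where B: "\<And>x y. inner (blinfun_apply A x) y = inner x (blinfun_apply B y)"
    and norm_B: "norm B \<le> norm A"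
    by (rule adjoint_blinfun_exists[of A]) (rule that)
  have "l2_adjoint A = B"
    unfolding l2_adjoint_def l2_cinner_adjoint_iff[OF A]
  proof (rule the_equality)
    fix C assume C: "\<forall>f g. inner (blinfun_apply A f) g = inner f (blinfun_apply C g)"
    have "C g = B g" for g
      using B C by (intro vector_eq_ldot[THEN iffD1]) simp
    then show "C = B" by (rule blinfun_eqI)
  qed (simp add: B)
  with B norm_B show "inner (blinfun_apply A f) g = inner f (blinfun_apply (l2_adjoint A) g)"
    "norm (l2_adjoint A) \<le> norm A" by simp_all
qed

lemma positive_l2_adjoint_compose:
  assumes "complex_linear A"
  shows "positive_blinfun (l2_adjoint A o\<^sub>L A)"
  unfolding positive_blinfun_def selfadjoint_def blinfun_apply_blinfun_compose
  by (metis inner_commute inner_ge_zero inner_l2_adjoint[OF assms])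

text \<open>
  On the spectral interval the square root is at most \<open>sqrt (norm (l2_adjoint A o\<^sub>L A))\<close>, hence at most
  \<open>norm A\<close>. The bound confines the functional calculus of the absolute value to \<open>[0, norm A]\<close>, as the
  endpoint \<open>p = \<infinity>\<close> requires.
\<close>

lemma
  assumes A: "complex_linear A"
  shows positive_blinfun_abs: "positive_blinfun (blinfun_abs A)"
    and norm_blinfun_abs_le: "norm (blinfun_abs A) \<le> norm A"
proof -
  let ?B = "l2_adjoint A o\<^sub>L A"
  have cont: "continuous_on {0..norm ?B} sqrt"
    by (intro continuous_intros)
  note pos = positive_l2_adjoint_compose[OF A]
  show "positive_blinfun (blinfun_abs A)"
    unfolding blinfun_abs_def by (rule positive_fun_calc[OF pos cont]) simp
  have "norm ?B \<le> norm A * norm A"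
    by (rule order_trans[OF norm_blinfun_compose]) (simp add: mult_right_mono norm_l2_adjoint_le[OF A])
  then have "sqrt t \<le> norm A" if "t \<in> {0..norm ?B}" for t
    using that by (intro real_le_lsqrt) (auto simp: power2_eq_square)
  then show "norm (blinfun_abs A) \<le> norm A"
    unfolding blinfun_abs_def by (intro norm_fun_calc_le[OF pos cont]) simp
qed

text \<open>
  The inequality holds for the quadratic forms at every basis vector; it is summed over finite subsets of
  the basis, whose supremum is the trace.
\<close>

lemma trace_pos_le_combination:
  fixes T R S :: "'n::finite l2 \<Rightarrow>\<^sub>L 'n l2"
  assumes le: "\<And>x. inner (T x) x \<le> a * inner (R x) x + b * inner (S x) x"
    and nonneg: "0 \<le> a" "0 \<le> b" "\<And>x. 0 \<le> inner (R x) x" "\<And>x. 0 \<le> inner (S x) x"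
  shows "trace_pos T \<le> ennreal a * trace_pos R + ennreal b * trace_pos S"
proof -
  define E where "E = (SOME E :: 'n l2 set. orthonormal_basis E)"
  have trace: "trace_pos Q = (SUP F\<in>{F. finite F \<and> F \<subseteq> E}. \<Sum>e\<in>F. ennreal (inner (Q e) e))" for Q :: "'n l2 \<Rightarrow>\<^sub>L 'n l2"
    unfolding trace_pos_def E_def[symmetric] inner_l2_def[symmetric]
    by (rule nonneg_infsum_complete) simp
  show ?thesis
    unfolding trace[of T]
  proof (rule SUP_least)
    fix F assume F: "F \<in> {F. finite F \<and> F \<subseteq> E}"
    have "(\<Sum>e\<in>F. ennreal (inner (T e) e))
        \<le> (\<Sum>e\<in>F. ennreal a * ennreal (inner (R e) e) + ennreal b * ennreal (inner (S e) e))"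
    proof (intro sum_mono)
      fix e
      have "ennreal (inner (T e) e) \<le> ennreal (a * inner (R e) e + b * inner (S e) e)"
        by (intro ennreal_leI le)
      also have "\<dots> = ennreal a * ennreal (inner (R e) e) + ennreal b * ennreal (inner (S e) e)"
        using nonneg by (simp add: ennreal_plus ennreal_mult)
      finally show "ennreal (inner (T e) e)
          \<le> ennreal a * ennreal (inner (R e) e) + ennreal b * ennreal (inner (S e) e)" .
    qed
    also have "\<dots> = ennreal a * (\<Sum>e\<in>F. ennreal (inner (R e) e))
        + ennreal b * (\<Sum>e\<in>F. ennreal (inner (S e) e))"
      by (simp only: sum.distrib sum_distrib_left)
    also have "\<dots> \<le> ennreal a * trace_pos R + ennreal b * trace_pos S"
      unfolding trace by (intro add_mono mult_left_mono SUP_upper F) auto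
    finally show "(\<Sum>e\<in>F. ennreal (inner (T e) e)) \<le> ennreal a * trace_pos R + ennreal b * trace_pos S" .
  qed
qed

lemma powr_convex_combination_le:
  fixes t a b s c :: real
  assumes "0 \<le> t" "0 < c" "0 < s" "s < 1"
  shows "t powr ((1 - s) * a + s * b)
    \<le> (1 - s) * c powr s * t powr a + s * c powr (s - 1) * t powr b"
proof -
  have "t powr ((1 - s) * a + s * b) = (t powr a) powr (1 - s) * (t powr b) powr s"
    by (simp add: powr_add powr_powr mult.commute)
  then show ?thesis
    using weighted_geometric_le_arithmetic[of "t powr a" "t powr b" c s] assms by simp
qed

lemma powr_le_bounded:
  fixes t a b K :: real
  assumes "0 \<le> t" "t \<le> K" "a \<le> b"
  shows "t powr b \<le> K powr (b - a) * t powr a"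
proof -
  have "t powr b = t powr (b - a) * t powr a"
    by (simp add: powr_add[symmetric])
  also have "\<dots> \<le> K powr (b - a) * t powr a"
    using assms by (intro mult_right_mono powr_mono2) auto
  finally show ?thesis .
qed

text \<open>
  This transports scalar inequalities between powers of \<open>t\<close> to traces of powers of an operator: the functional
  calculus yields them for the quadratic forms, and the trace is monotone in these.
\<close>

lemma trace_powr_le_combination:
  assumes B: "positive_blinfun B"
    and exps: "0 < a" "0 < b" "0 < q" and coeffs: "0 \<le> \<alpha>" "0 \<le> \<beta>"
    and le: "\<And>t. 0 \<le> t \<Longrightarrow> t \<le> norm B \<Longrightarrow> t powr q \<le> \<alpha> * t powr a + \<beta> * t powr b"
  shows "trace_pos (fun_calc (\<lambda>t. t powr q) B)
    \<le> ennreal \<alpha> * trace_pos (fun_calc (\<lambda>t. t powr a) B) + ennreal \<beta> * trace_pos (fun_calc (\<lambda>t. t powr b) B)"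
proof (rule trace_pos_le_combination)
  have cont: "continuous_on {0..norm B} (\<lambda>t. t powr r)" if "0 < r" for r
    by (intro continuous_on_powr' continuous_on_id continuous_on_const) (use that in auto)
  show "inner (fun_calc (\<lambda>t. t powr q) B x) x
      \<le> \<alpha> * inner (fun_calc (\<lambda>t. t powr a) B x) x + \<beta> * inner (fun_calc (\<lambda>t. t powr b) B x) x" for x
    using fun_calc_combination_nonneg[OF B cont[OF exps(1)] cont[OF exps(2)] cont[OF exps(3)], of \<alpha> \<beta> "- 1" x] le
    by simp
  show "0 \<le> inner (fun_calc (\<lambda>t. t powr a) B x) x" "0 \<le> inner (fun_calc (\<lambda>t. t powr b) B x) x" for x
    using positive_fun_calc[OF B cont[OF exps(1)]] positive_fun_calc[OF B cont[OF exps(2)]]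
    by (auto simp: positive_blinfun_def)
qed (use coeffs in auto)

section \<open>Interpolation of norms\<close>

lemma ennreal_powr_ennreal: "0 \<le> x \<Longrightarrow> ennreal_powr (ennreal x) a = ennreal (x powr a)"
  by (simp add: ennreal_powr_def)

lemma ennreal_powr_less_top_iff: "ennreal_powr x a < top \<longleftrightarrow> x < top"
  by (simp add: ennreal_powr_def less_top[symmetric])

text \<open>
  The part of the argument shared by functions and operators. The family \<open>M\<close> stands for the moments
  \<open>\<integral>\<bar>f\<bar>\<^sup>a\<close> or \<open>tr \<bar>A\<bar>\<^sup>a\<close>, and \<open>N\<close> for the norms derived from them. For finite \<open>p\<^sub>1\<close> write \<open>p\<^sub>\<theta> = (1 - s) p\<^sub>0 + s p\<^sub>1\<close>; the
  defining relation of \<open>p\<^sub>\<theta>\<close> gives \<open>s = \<theta> p\<^sub>\<theta> / p\<^sub>1\<close> and \<open>1 - s = (1 - \<theta>) p\<^sub>\<theta> / p\<^sub>0\<close>. Optimising the scale \<open>c\<close> in the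
  linear bound shows that \<open>M p\<^sub>\<theta>\<close> is at most the weighted geometric mean of \<open>M p\<^sub>0\<close> and \<open>M p\<^sub>1\<close>, and the root of order
  \<open>p\<^sub>\<theta>\<close> turns \<open>s\<close> into \<open>\<theta>\<close>. For \<open>p\<^sub>1 = \<infinity>\<close> the surplus power \<open>p\<^sub>\<theta> - p\<^sub>0 = \<theta> p\<^sub>\<theta>\<close> is absorbed by the uniform norm.
\<close>

lemma moment_interpolation:
  fixes M :: "real \<Rightarrow> ennreal" and N :: "ennreal \<Rightarrow> ennreal" and p\<^sub>0 p\<^sub>1 p\<^sub>\<theta> :: ennreal and \<theta> :: real
  assumes norm_eq: "\<And>p. p \<noteq> \<infinity> \<Longrightarrow> N p = ennreal_powr (M (enn2real p)) (1 / enn2real p)"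
    and convex: "\<And>a b s c. 0 < a \<Longrightarrow> a < b \<Longrightarrow> 0 < s \<Longrightarrow> s < 1 \<Longrightarrow> 0 < c \<Longrightarrow>
      M ((1 - s) * a + s * b) \<le> ennreal ((1 - s) * c powr s) * M a + ennreal (s * c powr (s - 1)) * M b"
    and bounded: "\<And>a b. 0 < a \<Longrightarrow> a < b \<Longrightarrow> N \<infinity> < \<infinity> \<Longrightarrow>
      M b \<le> ennreal (enn2real (N \<infinity>) powr (b - a)) * M a"
    and p: "1 \<le> p\<^sub>0" "p\<^sub>0 < p\<^sub>1"
    and \<theta>: "0 < \<theta>" "\<theta> < 1"
    and p\<^sub>\<theta>: "1 / p\<^sub>\<theta> = ennreal (1 - \<theta>) / p\<^sub>0 + ennreal \<theta> / p\<^sub>1"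
    and fin: "N p\<^sub>0 < \<infinity>" "N p\<^sub>1 < \<infinity>"
  shows "N p\<^sub>\<theta> \<le> ennreal_powr (N p\<^sub>0) (1 - \<theta>) * ennreal_powr (N p\<^sub>1) \<theta>"
proof -
  have "p\<^sub>0 \<noteq> \<infinity>" using p(2) by auto
  then obtain r\<^sub>0 where r\<^sub>0: "p\<^sub>0 = ennreal r\<^sub>0" "1 \<le> r\<^sub>0"
    using p(1) by (cases p\<^sub>0) auto
  have p\<^sub>0_part: "ennreal (1 - \<theta>) / p\<^sub>0 = ennreal ((1 - \<theta>) / r\<^sub>0)"
    using r\<^sub>0 \<theta> by (simp add: divide_ennreal)
  have "M r\<^sub>0 < \<infinity>"
    using fin(1) r\<^sub>0 by (simp add: norm_eq ennreal_powr_less_top_iff)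
  then obtain x where x: "M r\<^sub>0 = ennreal x" "0 \<le> x"
    by (cases "M r\<^sub>0") auto
  have N0: "N p\<^sub>0 = ennreal (x powr (1 / r\<^sub>0))"
    using r\<^sub>0 x by (simp add: norm_eq ennreal_powr_ennreal)
  \<comment> \<open>The relation between the exponents forces \<open>p\<^sub>\<theta>\<close> to be positive and finite, as \<open>1 / 0 = \<infinity>\<close> and \<open>1 / \<infinity> = 0\<close>.\<close>
  have exponent: "\<exists>q. p\<^sub>\<theta> = ennreal q \<and> 0 < q \<and> 1 / q = u" if u: "1 / p\<^sub>\<theta> = ennreal u" "0 < u" for u
  proof (cases p\<^sub>\<theta>)
    case (real q)
    with u have "q \<noteq> 0" by (auto simp: ennreal_divide_zero)
    then show ?thesis using real u by (auto simp: divide_ennreal simp flip: ennreal_1)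
  qed (use u in auto)
  show ?thesis
  proof (cases "p\<^sub>1 = \<infinity>")
    case True
    then obtain q where q: "p\<^sub>\<theta> = ennreal q" "0 < q" "1 / q = (1 - \<theta>) / r\<^sub>0"
      using exponent[of "(1 - \<theta>) / r\<^sub>0"] p\<^sub>\<theta> p\<^sub>0_part r\<^sub>0 \<theta> by auto
    then have q_eq: "q * (1 - \<theta>) = r\<^sub>0" using r\<^sub>0 by (simp add: field_simps)
    then have "r\<^sub>0 < q" using q \<theta> by (metis mult.right_neutral mult_less_cancel_left_pos diff_less_eq less_add_same_cancel1)
    obtain K where K: "N \<infinity> = ennreal K" "0 \<le> K"
      using fin(2) True by (cases "N \<infinity>") auto
    have "M q \<le> ennreal (K powr (q - r\<^sub>0)) * ennreal x"
      using bounded[of r\<^sub>0 q] \<open>r\<^sub>0 < q\<close> r\<^sub>0 fin(2) True K x by simp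
    also have "\<dots> = ennreal (K powr (q - r\<^sub>0) * x)"
      by (simp add: ennreal_mult x)
    finally have Mq: "M q \<le> ennreal (K powr (q - r\<^sub>0) * x)" .
    then obtain y where y: "M q = ennreal y" "0 \<le> y" "y \<le> K powr (q - r\<^sub>0) * x"
      using x by (cases "M q") (auto simp: top_unique)
    have "y powr (1 / q) \<le> (K powr (q - r\<^sub>0) * x) powr (1 / q)"
      using y q(2) by (intro powr_mono2) simp_all
    also have "\<dots> = K powr ((q - r\<^sub>0) * (1 / q)) * x powr (1 / q)"
      using x by (simp add: powr_mult powr_powr)
    also have "(q - r\<^sub>0) * (1 / q) = \<theta>"
      using q(2) q_eq by (simp add: field_simps)
    also have "x powr (1 / q) = (x powr (1 / r\<^sub>0)) powr (1 - \<theta>)"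
      using q(3) by (simp add: powr_powr)
    finally have "y powr (1 / q) \<le> (x powr (1 / r\<^sub>0)) powr (1 - \<theta>) * K powr \<theta>"
      by (simp add: mult.commute)
    then show ?thesis
      using q y K True N0 by (simp add: norm_eq ennreal_powr_ennreal ennreal_mult[symmetric] ennreal_leI)
  next
    case False
    then obtain r\<^sub>1 where r\<^sub>1: "p\<^sub>1 = ennreal r\<^sub>1" "r\<^sub>0 < r\<^sub>1"
      using p(2) r\<^sub>0 by (cases p\<^sub>1) (auto simp: ennreal_less_iff)
    have "1 / p\<^sub>\<theta> = ennreal ((1 - \<theta>) / r\<^sub>0 + \<theta> / r\<^sub>1)"
      using p\<^sub>\<theta> p\<^sub>0_part r\<^sub>0 r\<^sub>1 \<theta> by (simp add: divide_ennreal)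
    moreover have "0 < (1 - \<theta>) / r\<^sub>0 + \<theta> / r\<^sub>1"
      using r\<^sub>0 r\<^sub>1 \<theta> by (intro add_pos_pos) auto
    ultimately obtain q where q: "p\<^sub>\<theta> = ennreal q" "0 < q" "1 / q = (1 - \<theta>) / r\<^sub>0 + \<theta> / r\<^sub>1"
      using exponent by blast
    define s where "s = \<theta> * q / r\<^sub>1"
    have s1: "1 - s = (1 - \<theta>) * q / r\<^sub>0"
    proof -
      have "1 = q * ((1 - \<theta>) / r\<^sub>0 + \<theta> / r\<^sub>1)" using q by (simp flip: q(3))
      then show ?thesis by (simp add: s_def algebra_simps)
    qed
    have s: "0 < s" "s < 1"
    proof -
      show "0 < s" using q \<theta> r\<^sub>0 r\<^sub>1 by (simp add: s_def)
      have "0 < 1 - s" unfolding s1 using q \<theta> r\<^sub>0 by simp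
      then show "s < 1" by simp
    qed
    have q_eq: "q = (1 - s) * r\<^sub>0 + s * r\<^sub>1"
    proof -
      have "(1 - s) * r\<^sub>0 = (1 - \<theta>) * q" "s * r\<^sub>1 = \<theta> * q"
        unfolding s1 using r\<^sub>0 r\<^sub>1 by (simp_all add: s_def)
      then show ?thesis by (simp add: algebra_simps)
    qed
    have "M r\<^sub>1 < \<infinity>"
      using fin(2) r\<^sub>0 r\<^sub>1 by (simp add: norm_eq ennreal_powr_less_top_iff)
    then obtain z where z: "M r\<^sub>1 = ennreal z" "0 \<le> z"
      by (cases "M r\<^sub>1") auto
    have N1: "N p\<^sub>1 = ennreal (z powr (1 / r\<^sub>1))"
      using r\<^sub>0 r\<^sub>1 z by (simp add: norm_eq ennreal_powr_ennreal)
    have Mq: "M q \<le> ennreal ((1 - s) * c powr s * x + s * c powr (s - 1) * z)" if "0 < c" for c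
      using convex[of r\<^sub>0 r\<^sub>1 s c] s r\<^sub>0 r\<^sub>1 x z that
      by (simp add: q_eq[symmetric] ennreal_mult[symmetric] ennreal_plus[symmetric] del: ennreal_plus)
    obtain y where y: "M q = ennreal y" "0 \<le> y"
      using Mq[of 1] by (cases "M q") (auto simp: top_unique)
    have "y \<le> x powr (1 - s) * z powr s"
    proof (rule le_weighted_geometric_mean)
      fix c :: real assume "0 < c"
      then show "y \<le> (1 - s) * c powr s * x + s * c powr (s - 1) * z"
        using Mq[OF \<open>0 < c\<close>] x z s by (simp only: y(1), subst (asm) ennreal_le_iff) auto
    qed (use x z s in auto)
    then have "y powr (1 / q) \<le> (x powr (1 - s) * z powr s) powr (1 / q)"
      using y q(2) by (intro powr_mono2) simp_all
    also have "\<dots> = x powr ((1 - s) * (1 / q)) * z powr (s * (1 / q))"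
      by (simp add: powr_mult powr_powr)
    also have "(1 - s) * (1 / q) = (1 / r\<^sub>0) * (1 - \<theta>)"
      unfolding s1 using q(2) by simp
    also have "s * (1 / q) = (1 / r\<^sub>1) * \<theta>"
      using q(2) by (simp add: s_def)
    finally have "y powr (1 / q) \<le> (x powr (1 / r\<^sub>0)) powr (1 - \<theta>) * (z powr (1 / r\<^sub>1)) powr \<theta>"
      by (simp only: powr_powr)
    then show ?thesis
      using q y N0 N1 by (simp add: norm_eq ennreal_powr_ennreal ennreal_mult[symmetric] ennreal_leI)
  qed
qed

lemma Lp_norm_interpolation:
  fixes f :: "'a::euclidean_space \<Rightarrow> complex"
  assumes f: "f \<in> borel_measurable lebesgue"
    and "1 \<le> p\<^sub>0" "p\<^sub>0 < p\<^sub>1" "0 < \<theta>" "\<theta> < 1"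
    and "1 / p\<^sub>\<theta> = ennreal (1 - \<theta>) / p\<^sub>0 + ennreal \<theta> / p\<^sub>1"
    and "Lp_norm p\<^sub>0 f < \<infinity>" "Lp_norm p\<^sub>1 f < \<infinity>"
  shows "Lp_norm p\<^sub>\<theta> f \<le> ennreal_powr (Lp_norm p\<^sub>0 f) (1 - \<theta>) * ennreal_powr (Lp_norm p\<^sub>1 f) \<theta>"
proof (rule moment_interpolation[where N = "\<lambda>p. Lp_norm p f"
      and M = "\<lambda>a. \<integral>\<^sup>+x. ennreal (cmod (f x) powr a) \<partial>lebesgue", OF _ _ _ assms(2-)])
  note f[measurable]
  show "(\<integral>\<^sup>+x. ennreal (cmod (f x) powr ((1 - s) * a + s * b)) \<partial>lebesgue)
      \<le> ennreal ((1 - s) * c powr s) * (\<integral>\<^sup>+x. ennreal (cmod (f x) powr a) \<partial>lebesgue)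
        + ennreal (s * c powr (s - 1)) * (\<integral>\<^sup>+x. ennreal (cmod (f x) powr b) \<partial>lebesgue)"
    if "0 < a" "a < b" "0 < s" "s < 1" "0 < c" for a b s c
  proof -
    have "(\<integral>\<^sup>+x. ennreal (cmod (f x) powr ((1 - s) * a + s * b)) \<partial>lebesgue)
        \<le> (\<integral>\<^sup>+x. ennreal ((1 - s) * c powr s) * ennreal (cmod (f x) powr a)
          + ennreal (s * c powr (s - 1)) * ennreal (cmod (f x) powr b) \<partial>lebesgue)"
    proof (rule nn_integral_mono)
      fix x
      have "ennreal (cmod (f x) powr ((1 - s) * a + s * b))
          \<le> ennreal ((1 - s) * c powr s * cmod (f x) powr a + s * c powr (s - 1) * cmod (f x) powr b)"
        using that by (intro ennreal_leI powr_convex_combination_le) auto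
      then show "ennreal (cmod (f x) powr ((1 - s) * a + s * b))
          \<le> ennreal ((1 - s) * c powr s) * ennreal (cmod (f x) powr a)
            + ennreal (s * c powr (s - 1)) * ennreal (cmod (f x) powr b)"
        using that by (simp add: ennreal_mult)
    qed
    also have "\<dots> = ennreal ((1 - s) * c powr s) * (\<integral>\<^sup>+x. ennreal (cmod (f x) powr a) \<partial>lebesgue)
        + ennreal (s * c powr (s - 1)) * (\<integral>\<^sup>+x. ennreal (cmod (f x) powr b) \<partial>lebesgue)"
      by (simp add: nn_integral_add nn_integral_cmult)
    finally show ?thesis .
  qed
  show "(\<integral>\<^sup>+x. ennreal (cmod (f x) powr b) \<partial>lebesgue)
      \<le> ennreal (enn2real (Lp_norm \<infinity> f) powr (b - a)) * (\<integral>\<^sup>+x. ennreal (cmod (f x) powr a) \<partial>lebesgue)"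
    if ab: "0 < a" "a < b" and fin: "Lp_norm \<infinity> f < \<infinity>" for a b
  proof -
    define K where "K = enn2real (Lp_norm \<infinity> f)"
    have "AE x in lebesgue. ennreal (cmod (f x)) \<le> Lp_norm \<infinity> f"
      unfolding Lp_norm_def using esssup_AE[of "\<lambda>x. ennreal (cmod (f x))" lebesgue] by simp
    then have "AE x in lebesgue. cmod (f x) \<le> K"
      by eventually_elim (use fin in \<open>cases "Lp_norm \<infinity> f", auto simp: K_def\<close>)
    then have "(\<integral>\<^sup>+x. ennreal (cmod (f x) powr b) \<partial>lebesgue)
        \<le> (\<integral>\<^sup>+x. ennreal (K powr (b - a)) * ennreal (cmod (f x) powr a) \<partial>lebesgue)"
    proof (intro nn_integral_mono_AE, eventually_elim)
      case (elim x)
      then have "ennreal (cmod (f x) powr b) \<le> ennreal (K powr (b - a) * cmod (f x) powr a)"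
        using ab by (intro ennreal_leI powr_le_bounded) auto
      then show ?case by (simp add: ennreal_mult)
    qed
    then show ?thesis by (simp add: nn_integral_cmult K_def)
  qed
qed (simp add: Lp_norm_def)

lemma schatten_norm_interpolation:
  assumes A: "complex_linear A"
    and "1 \<le> p\<^sub>0" "p\<^sub>0 < p\<^sub>1" "0 < \<theta>" "\<theta> < 1"
    and "1 / p\<^sub>\<theta> = ennreal (1 - \<theta>) / p\<^sub>0 + ennreal \<theta> / p\<^sub>1"
    and "schatten_norm p\<^sub>0 A < \<infinity>" "schatten_norm p\<^sub>1 A < \<infinity>"
  shows "schatten_norm p\<^sub>\<theta> A
    \<le> ennreal_powr (schatten_norm p\<^sub>0 A) (1 - \<theta>) * ennreal_powr (schatten_norm p\<^sub>1 A) \<theta>"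
proof (rule moment_interpolation[where N = "\<lambda>p. schatten_norm p A"
      and M = "\<lambda>a. trace_pos (fun_calc (\<lambda>t. t powr a) (blinfun_abs A))", OF _ _ _ assms(2-)])
  note pos = positive_blinfun_abs[OF A]
  show "trace_pos (fun_calc (\<lambda>t. t powr ((1 - s) * a + s * b)) (blinfun_abs A))
      \<le> ennreal ((1 - s) * c powr s) * trace_pos (fun_calc (\<lambda>t. t powr a) (blinfun_abs A))
        + ennreal (s * c powr (s - 1)) * trace_pos (fun_calc (\<lambda>t. t powr b) (blinfun_abs A))"
    if "0 < a" "a < b" "0 < s" "s < 1" "0 < c" for a b s c
    using that
    by (intro trace_powr_le_combination[OF pos] powr_convex_combination_le) (auto intro: add_pos_pos)
  show "trace_pos (fun_calc (\<lambda>t. t powr b) (blinfun_abs A))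
      \<le> ennreal (enn2real (schatten_norm \<infinity> A) powr (b - a))
        * trace_pos (fun_calc (\<lambda>t. t powr a) (blinfun_abs A))"
    if "0 < a" "a < b" for a b
  proof -
    have "t powr b \<le> norm A powr (b - a) * t powr a" if "0 \<le> t" "t \<le> norm (blinfun_abs A)" for t
      using that \<open>a < b\<close> norm_blinfun_abs_le[OF A] by (intro powr_le_bounded) auto
    then have "trace_pos (fun_calc (\<lambda>t. t powr b) (blinfun_abs A))
        \<le> ennreal (norm A powr (b - a)) * trace_pos (fun_calc (\<lambda>t. t powr a) (blinfun_abs A))
          + ennreal 0 * trace_pos (fun_calc (\<lambda>t. t powr a) (blinfun_abs A))"
      using that by (intro trace_powr_le_combination[OF pos]) auto
    then show ?thesis by (simp add: schatten_norm_def)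
  qed
qed (simp add: schatten_norm_def)

lemma Hoelder_two_terms_ennreal:
  fixes a\<^sub>0 a\<^sub>1 b\<^sub>0 b\<^sub>1 :: ennreal
  assumes "a\<^sub>0 < \<infinity>" "a\<^sub>1 < \<infinity>" "b\<^sub>0 < \<infinity>" "b\<^sub>1 < \<infinity>" "0 < s" "s < 1"
  shows "ennreal_powr a\<^sub>0 (1 - s) * ennreal_powr a\<^sub>1 s + ennreal_powr b\<^sub>0 (1 - s) * ennreal_powr b\<^sub>1 s
    \<le> ennreal_powr (a\<^sub>0 + b\<^sub>0) (1 - s) * ennreal_powr (a\<^sub>1 + b\<^sub>1) s"
proof -
  obtain x\<^sub>0 x\<^sub>1 y\<^sub>0 y\<^sub>1 where "a\<^sub>0 = ennreal x\<^sub>0" "a\<^sub>1 = ennreal x\<^sub>1" "b\<^sub>0 = ennreal y\<^sub>0" "b\<^sub>1 = ennreal y\<^sub>1"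
    and "0 \<le> x\<^sub>0" "0 \<le> x\<^sub>1" "0 \<le> y\<^sub>0" "0 \<le> y\<^sub>1"
    using assms(1-4) by (metis enn2real_nonneg ennreal_enn2real infinity_ennreal_def)
  then show ?thesis
    using Hoelder_two_terms[of x\<^sub>0 x\<^sub>1 y\<^sub>0 y\<^sub>1 s] assms(5,6)
    by (simp add: ennreal_powr_ennreal ennreal_mult[symmetric] ennreal_plus[symmetric] ennreal_leI del: ennreal_plus)
qed

theorem theorem3p4:
  fixes p\<^sub>0 p\<^sub>1 p\<^sub>\<theta> :: ennreal and \<theta> :: real
    and f :: "real ^ ('n::finite + 'n) \<Rightarrow> complex" and A :: "'n l2 \<Rightarrow>\<^sub>L 'n l2"
  assumes "1 \<le> p\<^sub>0" and "p\<^sub>0 < p\<^sub>1" and "p\<^sub>1 \<le> \<infinity>"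
    and "0 < \<theta>" and "\<theta> < 1"
    and "1 / p\<^sub>\<theta> = ennreal (1 - \<theta>) / p\<^sub>0 + ennreal \<theta> / p\<^sub>1"
    and "(f, A) \<in> Lp_QHA p\<^sub>0 \<inter> Lp_QHA p\<^sub>1"
  shows "QHA_norm p\<^sub>\<theta> (f, A)
           \<le> ennreal_powr (QHA_norm p\<^sub>0 (f, A)) (1 - \<theta>) * ennreal_powr (QHA_norm p\<^sub>1 (f, A)) \<theta>"
proof -
  have f: "f \<in> borel_measurable lebesgue" and A: "complex_linear A"
    using assms(7) by (auto simp: Lp_QHA_def schatten_class_def)
  have fin: "Lp_norm p\<^sub>0 f < \<infinity>" "Lp_norm p\<^sub>1 f < \<infinity>" "schatten_norm p\<^sub>0 A < \<infinity>" "schatten_norm p\<^sub>1 A < \<infinity>"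
    using assms(7) by (auto simp: Lp_QHA_def QHA_norm_def)
  have "QHA_norm p\<^sub>\<theta> (f, A) \<le> ennreal_powr (Lp_norm p\<^sub>0 f) (1 - \<theta>) * ennreal_powr (Lp_norm p\<^sub>1 f) \<theta>
      + ennreal_powr (schatten_norm p\<^sub>0 A) (1 - \<theta>) * ennreal_powr (schatten_norm p\<^sub>1 A) \<theta>"
    unfolding QHA_norm_def prod.case
    by (intro add_mono Lp_norm_interpolation[OF f assms(1,2,4,5,6)]
        schatten_norm_interpolation[OF A assms(1,2,4,5,6)] fin)
  also have "\<dots> \<le> ennreal_powr (QHA_norm p\<^sub>0 (f, A)) (1 - \<theta>) * ennreal_powr (QHA_norm p\<^sub>1 (f, A)) \<theta>"
    unfolding QHA_norm_def prod.case using fin assms(4,5) by (intro Hoelder_two_terms_ennreal)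
  finally show ?thesis .
qed

end
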